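(* Let $k\ge 1$ be an integer and let $c_0,c_1,\ldots,c_{k-1}$ be real numbers. Put $I=\{1\le j\le k-1 : c_j\neq 0\}$ and assume $I\neq\emptyset$. Let $$p(x)=x^k-c_{k-1}x^{k-1}-\cdots-c_1x-c_0 .$$ (1) If $c_i\ge 0$ for all $i$ and $c_0>0$, then the following two conditions are equivalent: (i) $p$ has a unique positive root $\rho$, and $|\zeta|<\rho$ for every other complex zero $\zeta$ of $p$, zeros being counted with multiplicity (so in particular $\rho$ is a simple root); (ii) $\gcd(I\cup\{k\})=1$. (2) If $c_{k-1}\ge 2$ and $c_{k-1}>\sum_{j=0}^{k-2}|c_j|+1$, then $p$ has a simple real root $\rho$ with $c_{k-1}-1<\rho<c_{k-1}+1$, and every other complex root $\zeta$ of $p$ satisfies $|\zeta|<1$. (3) Suppose that one of the following holds: (A) $c_i\ge 0$ for all $i$, $c_0>0$ and $\gcd(I\cup\{k\})=1$; or (B) $c_{k-1}\ge 2$ and $c_{k-1}>\sum_{j=0}^{k-2}|c_j|+1$. Let $\rho$ be the root of $p$ given by (1) in case (A), respectively by (2) in case (B). Let $b>2$ be an integer such that $\log_b(\rho)$ is irrational, and let $(a_n)_{n\ge 1}$ be a sequence of strictly positive real numbers satisfying $$a_{n+k}=c_{k-1}a_{n+k-1}+\cdots+c_1a_{n+1}+c_0a_n\qquad\text{for all } n\ge 1 .$$ In case (B), assume moreover that $(a_n)$ does not tend to $0$. Then $(a_n)_{n\ge 1}$ satisfies Benford's law in base $b$. Moreover, for every non-constant polynomial $Q(x)$ with integer coefficients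 such that $Q(x)\ge 1$ for all sufficiently large $x$, the subsequence $(a_{Q(n)})$ also satisfies Benford's law in base $b$.
   Context: For an integer $b>2$ and a real number $u>0$, the mantissa $M_b(u)$ is the unique element of $[1,b)$ such that $u=M_b(u)\cdot b^m$ for some $m\in\mathbb{Z}$. A sequence $(u_n)_{n\ge 1}$ of strictly positive real numbers satisfies Benford's law in base $b$ if for every $t\in[1,b)$, $$\lim_{N\to\infty}\frac{|\{1\le n\le N : M_b(u_n)<t\}|}{N}=\log_b(t).$$ The sequence $(a_{Q(n)})$ is considered for $n$ large enough that $Q(n)\ge 1$; finitely many indices do not affect Benford's law. *)

theory Defs
  imports "HOL-Analysis.Analysis" "HOL-Computational_Algebra.Computational_Algebra"
begin

text \<open>Only the values \<open>c 0, \<dots>, c (k - 1)\<close> of the coefficient function are used.\<close>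

definition rec_poly :: "nat \<Rightarrow> (nat \<Rightarrow> real) \<Rightarrow> real poly" where
  "rec_poly k c = monom 1 k - (\<Sum>j<k. monom (c j) j)"

definition inner_support :: "nat \<Rightarrow> (nat \<Rightarrow> real) \<Rightarrow> nat set" where
  "inner_support k c = {j \<in> {1..k - 1}. c j \<noteq> 0}"

abbreviation complex_poly :: "real poly \<Rightarrow> complex poly" where
  "complex_poly p \<equiv> map_poly complex_of_real p"

text \<open>\<open>proots\<close> is the multiset of zeros, so removing one copy of \<open>\<rho>\<close> leaves the other
  zeros counted with multiplicity; in particular the last conjunct forces \<open>\<rho>\<close> to be simple.\<close>

definition dominant_root :: "real poly \<Rightarrow> real \<Rightarrow> bool" where
  "dominant_root p \<rho> \<longleftrightarrow>
     \<rho> > 0 \<and> poly p \<rho> = 0 \<and> (\<forall>x>0. poly p x = 0 \<longrightarrow> x = \<rho>) \<and>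
     (\<forall>\<zeta> \<in># proots (complex_poly p) - {#complex_of_real \<rho>#}. cmod \<zeta> < \<rho>)"

definition isolated_root_near :: "real \<Rightarrow> real poly \<Rightarrow> real \<Rightarrow> bool" where
  "isolated_root_near d p \<rho> \<longleftrightarrow>
     poly p \<rho> = 0 \<and> order \<rho> p = 1 \<and> d - 1 < \<rho> \<and> \<rho> < d + 1 \<and>
     (\<forall>\<zeta>. poly (complex_poly p) \<zeta> = 0 \<and> \<zeta> \<noteq> complex_of_real \<rho> \<longrightarrow> cmod \<zeta> < 1)"

definition large_top_coeff :: "nat \<Rightarrow> (nat \<Rightarrow> real) \<Rightarrow> bool" where
  "large_top_coeff k c \<longleftrightarrow>
     c (k - 1) \<ge> 2 \<and> c (k - 1) > (\<Sum>j\<in>{0..<k - 1}. \<bar>c j\<bar>) + 1"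

definition mantissa :: "nat \<Rightarrow> real \<Rightarrow> real" where
  "mantissa b u = (THE x. x \<in> {1..<real b} \<and> (\<exists>m::int. u = x * real b powi m))"

text \<open>Sequences are indexed from \<open>1\<close>; the value at \<open>0\<close> is irrelevant.\<close>

definition benford :: "nat \<Rightarrow> (nat \<Rightarrow> real) \<Rightarrow> bool" where
  "benford b u \<longleftrightarrow>
     (\<forall>n\<ge>1. u n > 0) \<and>
     (\<forall>t\<in>{1..<real b}.
        (\<lambda>N. real (card {n \<in> {1..N}. mantissa b (u n) < t}) / real N) \<longlonglongrightarrow> log (real b) t)"

end

theory Submission
  imports Defs
begin

text \<open>For nonnegative coefficients, a root of maximal modulus turns the triangle inequality for
  \<open>\<zeta>\<^sup>k = \<Sum>c\<^sub>j \<zeta>\<^sup>j\<close> into an equality, so \<open>\<zeta> / \<rho>\<close> is a root of unity of every order in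
  \<open>I \<union> {k}\<close>. For a large top coefficient, \<open>p = (x - \<rho>) q\<close> where the lower coefficients of the
  monic \<open>q\<close> have absolute values summing to less than 1.

  In both cases, writing \<open>p = (x - \<rho>) q\<close> in the shift operator, \<open>q\<close> annihilates
  \<open>a\<^sub>n - K \<rho>\<^sup>n\<close> for a suitable \<open>K\<close>, whence \<open>a\<^sub>n / \<rho>\<^sup>n\<close> converges to \<open>K\<close>, and \<open>K > 0\<close>.
  Thus \<open>log\<^sub>b a\<^bsub>Q(n)\<^esub>\<close> differs from the polynomial \<open>Q(n) log\<^sub>b \<rho> + log\<^sub>b K\<close>, whose leading coefficient is
  irrational, by a null sequence. It is equidistributed modulo 1 by van der Corput's difference
  method and Weyl's criterion, and this is Benford's law.\<close>

section \<open>Exponential sums\<close>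

definition mean_null :: "(nat \<Rightarrow> complex) \<Rightarrow> bool" where
  "mean_null u \<longleftrightarrow> (\<lambda>N. (\<Sum>n<N. u n) / of_nat N) \<longlonglongrightarrow> 0"

lemma mean_null_add: "mean_null u \<Longrightarrow> mean_null v \<Longrightarrow> mean_null (\<lambda>n. u n + v n)"
  unfolding mean_null_def by (drule (1) tendsto_add) (simp add: sum.distrib add_divide_distrib)

lemma mean_null_cmult: "mean_null u \<Longrightarrow> mean_null (\<lambda>n. c * u n)"
  unfolding mean_null_def
  by (drule tendsto_mult_left[of _ _ _ c]) (simp add: sum_distrib_left)

lemma mean_null_sum:
  "(\<And>i. i \<in> A \<Longrightarrow> mean_null (u i)) \<Longrightarrow> mean_null (\<lambda>n. \<Sum>i\<in>A. u i n)"
proof (induction A rule: infinite_finite_induct)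
  case (insert x F)
  then show ?case by (simp add: mean_null_add)
qed (simp_all add: mean_null_def)

lemma mean_null_cnj: "mean_null u \<Longrightarrow> mean_null (\<lambda>n. cnj (u n))"
  unfolding mean_null_def by (drule tendsto_cnj) simp

text \<open>The two sums telescope to \<open>u N - u 0\<close>, which stays bounded while the
  denominator grows.\<close>

lemma mean_Suc_diff:
  assumes "\<And>n. norm (u n) \<le> B"
  shows "(\<lambda>N. (\<Sum>n<N. u (Suc n)) / of_nat N - (\<Sum>n<N. u n) / of_nat N) \<longlonglongrightarrow> (0::complex)"
proof (rule Lim_null_comparison)
  have tel: "(\<Sum>n<N. u (Suc n)) - (\<Sum>n<N. u n) = u N - u 0" for N
    by (simp add: sum_lessThan_telescope flip: sum_subtractf)
  show "\<forall>\<^sub>F N in sequentially. norm ((\<Sum>n<N. u (Suc n)) / of_nat N - (\<Sum>n<N. u n) / of_nat N) \<le> (2 * B) * (1 / real N)"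
  proof (intro always_eventually allI)
    fix N
    have "norm (u N - u 0) \<le> 2 * B"
      using norm_triangle_ineq4[of "u N" "u 0"] assms[of N] assms[of 0] by linarith
    then show "norm ((\<Sum>n<N. u (Suc n)) / of_nat N - (\<Sum>n<N. u n) / of_nat N) \<le> (2 * B) * (1 / real N)"
      by (simp add: tel norm_divide divide_right_mono flip: diff_divide_distrib)
  qed
  show "(\<lambda>N. (2 * B) * (1 / real N)) \<longlonglongrightarrow> 0"
    using tendsto_mult_right_zero[OF lim_1_over_n] by simp
qed

lemma mean_shift_diff:
  assumes "\<And>n. norm (u n) \<le> B"
  shows "(\<lambda>N. (\<Sum>n<N. u (n + h)) / of_nat N - (\<Sum>n<N. u n) / of_nat N) \<longlonglongrightarrow> (0::complex)"
proof (induction h)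
  case (Suc h)
  have "(\<lambda>N. (\<Sum>n<N. u (Suc n + h)) / of_nat N - (\<Sum>n<N. u (n + h)) / of_nat N) \<longlonglongrightarrow> 0"
    using mean_Suc_diff[of "\<lambda>n. u (n + h)" B] assms by simp
  from tendsto_add[OF this Suc] show ?case by simp
qed simp

lemma mean_null_shift:
  assumes "\<And>n. norm (u n) \<le> B" "mean_null u"
  shows "mean_null (\<lambda>n. u (n + h))"
  using tendsto_add[OF mean_shift_diff[of u B h, OF assms(1)] assms(2)[unfolded mean_null_def]]
  by (simp add: mean_null_def)

text \<open>Beyond \<open>M\<close> the terms have norm below \<open>e / 2\<close>, and the fixed
  head sum \<open>S\<close> is eventually below \<open>real N * (e / 2)\<close>.\<close>

lemma mean_null_of_tendsto_0:
  assumes "u \<longlonglongrightarrow> 0"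
  shows "mean_null u"
  unfolding mean_null_def
proof (rule LIMSEQ_I)
  fix e :: real assume e: "e > 0"
  obtain M where M: "norm (u n) < e / 2" if "n \<ge> M" for n
    using LIMSEQ_D[OF assms, of "e / 2"] e by auto
  define S where "S = (\<Sum>n<M. norm (u n))"
  obtain N0 where N0: "real N0 > 2 * S / e" using reals_Archimedean2 by blast
  show "\<exists>no. \<forall>N\<ge>no. norm ((\<Sum>n<N. u n) / of_nat N - 0) < e"
  proof (intro exI[of _ "Suc (max M N0)"] allI impI)
    fix N assume N: "N \<ge> Suc (max M N0)"
    have "norm (\<Sum>n<N. u n) \<le> (\<Sum>n<N. norm (u n))" by (rule norm_sum)
    also have "(\<Sum>n<N. norm (u n)) = (\<Sum>n\<in>{..<M} \<union> {M..<N}. norm (u n))"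
      by (rule sum.cong) (use N in auto)
    also have "\<dots> = S + (\<Sum>n=M..<N. norm (u n))"
      unfolding S_def by (rule sum.union_disjoint) auto
    also have "(\<Sum>n=M..<N. norm (u n)) \<le> (\<Sum>n=M..<N. e / 2)"
      by (rule sum_mono) (use M in \<open>simp add: less_imp_le\<close>)
    also have "\<dots> \<le> real N * (e / 2)" using e by simp
    finally have 1: "norm (\<Sum>n<N. u n) \<le> S + real N * (e / 2)" by simp
    have "2 * S / e < real N" using N0 N by simp
    then have "S < real N * (e / 2)" using e by (simp add: field_simps)
    with 1 have "norm (\<Sum>n<N. u n) < real N * e" by simp
    moreover have "real N > 0" using N by simp
    ultimately show "norm ((\<Sum>n<N. u n) / of_nat N - 0) < e"
      by (simp add: norm_divide field_simps)
  qed
qed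

section \<open>Van der Corput's difference method\<close>

text \<open>Separates the diagonal, at most \<open>H\<close> for terms in the unit disc, from the
  products that are controlled by correlations.\<close>

lemma norm_sum_square_expand:
  "complex_of_real ((norm (\<Sum>h<H. f h))\<^sup>2) =
   (\<Sum>h<H. complex_of_real ((norm (f h))\<^sup>2)) + (\<Sum>h<H. \<Sum>h'\<in>{..<H}-{h}. f h * cnj (f h'))"
  for H :: nat
proof -
  have "complex_of_real ((norm (\<Sum>h<H. f h))\<^sup>2) = (\<Sum>h<H. \<Sum>h'<H. f h * cnj (f h'))"
    by (simp add: complex_norm_square sum_product del: of_real_power)
  also have "\<dots> = (\<Sum>h<H. f h * cnj (f h) + (\<Sum>h'\<in>{..<H}-{h}. f h * cnj (f h')))"
    by (intro sum.cong refl sum.remove) auto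
  finally show ?thesis by (simp add: sum.distrib complex_norm_square del: of_real_power)
qed

text \<open>Trades the mean of \<open>u\<close> for the means of its correlations. For a polynomial
  phase, the correlations have phases of smaller degree.\<close>

theorem van_der_Corput:
  assumes bound: "\<And>n. norm (u n) \<le> 1"
    and corr: "\<And>h. h > 0 \<Longrightarrow> mean_null (\<lambda>n. u (n + h) * cnj (u n))"
  shows "mean_null u"
proof -
  have bound2: "norm (u m * cnj (u n)) \<le> 1" for m n
    using mult_mono[of "norm (u m)" 1 "norm (u n)" 1] bound by (simp add: norm_mult)
  \<comment> \<open>Shifting by the smaller of \<open>h\<close> and \<open>h'\<close> leaves a
    correlation with positive lag; conjugation exchanges the factors when
    \<open>h < h'\<close>.\<close>
  have corr': "mean_null (\<lambda>n. u (n + h) * cnj (u (n + h')))" if "h \<noteq> h'" for h h'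
  proof (cases "h > h'")
    case True
    have "mean_null (\<lambda>n. u (n + (h - h')) * cnj (u n))" using True by (intro corr) simp
    from mean_null_shift[OF bound2 this, of h'] True show ?thesis by simp
  next
    case False
    have "mean_null (\<lambda>n. u (n + (h' - h)) * cnj (u n))" using False that by (intro corr) simp
    from mean_null_cnj[OF mean_null_shift[OF bound2 this, of h]] False show ?thesis
      by (simp add: mult.commute)
  qed
  \<comment> \<open>\<open>w H\<close> is a moving sum over a window of length \<open>H\<close>: its mean is \<open>H\<close> times that of \<open>u\<close>, while by
    Cauchy-Schwarz and the correlation hypothesis it is at most about \<open>\<surd>H\<close>.\<close>
  define w where "w H n = (\<Sum>h<H. u (n + h))" for H n
  define T where "T H n = (\<Sum>h<H. \<Sum>h'\<in>{..<H}-{h}. u (n + h) * cnj (u (n + h')))" for H n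
  have T: "mean_null (T H)" for H
    unfolding T_def by (intro mean_null_sum corr') auto
  have w_sq: "(norm (w H n))\<^sup>2 \<le> real H + Re (T H n)" for H n
  proof -
    have "(norm (w H n))\<^sup>2 = Re (complex_of_real ((norm (w H n))\<^sup>2))" by simp
    also have "\<dots> = (\<Sum>h<H. (norm (u (n + h)))\<^sup>2) + Re (T H n)"
      unfolding w_def T_def norm_sum_square_expand by (simp flip: of_real_power)
    also have "(\<Sum>h<H. (norm (u (n + h)))\<^sup>2) \<le> (\<Sum>h<H. 1)"
      by (intro sum_mono power_le_one) (use bound in auto)
    finally show ?thesis by simp
  qed
  have mean_w: "(norm ((\<Sum>n<N. w H n) / of_nat N))\<^sup>2 \<le> real H + norm ((\<Sum>n<N. T H n) / of_nat N)"
    for H N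
  proof (cases "N = 0")
    case False
    have "(norm (\<Sum>n<N. w H n))\<^sup>2 \<le> (\<Sum>n<N. norm (w H n))\<^sup>2"
      by (intro power_mono norm_sum) auto
    also have "\<dots> \<le> (\<Sum>n<N. (norm (w H n))\<^sup>2) * real N"
      using sum_squared_le_sum_of_squares[of "\<lambda>n. norm (w H n)" "{..<N}"] by simp
    also have "(\<Sum>n<N. (norm (w H n))\<^sup>2) \<le> (\<Sum>n<N. real H + Re (T H n))"
      by (intro sum_mono w_sq)
    also have "\<dots> = real N * real H + Re (\<Sum>n<N. T H n)" by (simp add: sum.distrib)
    also have "\<dots> \<le> real N * real H + norm (\<Sum>n<N. T H n)"
      by (intro add_left_mono complex_Re_le_cmod)
    finally have "(norm (\<Sum>n<N. w H n))\<^sup>2 \<le> (real N * real H + norm (\<Sum>n<N. T H n)) * real N"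
      by (simp add: mult_right_mono)
    then show ?thesis using False
      by (simp add: norm_divide power_divide field_simps power2_eq_square)
  qed simp
  have w_diff: "(\<lambda>N. (\<Sum>n<N. w H n) / of_nat N - of_nat H * ((\<Sum>n<N. u n) / of_nat N)) \<longlonglongrightarrow> 0" for H
  proof -
    have "(\<lambda>N. \<Sum>h<H. (\<Sum>n<N. u (n + h)) / of_nat N - (\<Sum>n<N. u n) / of_nat N) \<longlonglongrightarrow> (\<Sum>h<H. 0)"
      by (intro tendsto_sum mean_shift_diff[of _ 1] bound)
    moreover have "(\<Sum>h<H. (\<Sum>n<N. u (n + h)) / of_nat N - (\<Sum>n<N. u n) / of_nat N)
        = (\<Sum>n<N. w H n) / of_nat N - of_nat H * ((\<Sum>n<N. u n) / of_nat N)" for N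
      unfolding w_def
      by (subst sum.swap) (simp add: sum_subtractf sum_divide_distrib)
    ultimately show ?thesis by simp
  qed
  show ?thesis unfolding mean_null_def
  proof (rule LIMSEQ_I)
    fix e :: real assume e: "e > 0"
    \<comment> \<open>With a window of length \<open>m\<^sup>2\<close> the mean of
      \<open>w H\<close> has norm at most \<open>2 * m\<close>, so that of \<open>u\<close> has norm
      at most \<open>3 / m\<close>, which is below \<open>e\<close>.\<close>
    obtain m :: nat where m: "real m > 3 / e" using reals_Archimedean2 by blast
    have "0 < 3 / e" using e by simp
    then have m0: "real m > 0" using m by linarith
    then have m1: "real m \<ge> 1" by simp
    define H where "H = m\<^sup>2"
    have H: "real H = (real m)\<^sup>2" by (simp add: H_def)
    have "\<exists>no. \<forall>N\<ge>no. norm ((\<Sum>n<N. T H n) / of_nat N - 0) < real H"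
      using T[of H, unfolded mean_null_def] m0 H by (intro LIMSEQ_D) auto
    then obtain N1 where N1: "norm ((\<Sum>n<N. T H n) / of_nat N) < real H" if "N \<ge> N1" for N by auto
    have "\<exists>no. \<forall>N\<ge>no. norm ((\<Sum>n<N. w H n) / of_nat N - of_nat H * ((\<Sum>n<N. u n) / of_nat N) - 0) < 1"
      using w_diff[of H] by (intro LIMSEQ_D) auto
    then obtain N2 where N2: "norm ((\<Sum>n<N. w H n) / of_nat N - of_nat H * ((\<Sum>n<N. u n) / of_nat N)) < 1"
      if "N \<ge> N2" for N by auto
    show "\<exists>no. \<forall>N\<ge>no. norm ((\<Sum>n<N. u n) / of_nat N - 0) < e"
    proof (intro exI[of _ "max N1 N2"] allI impI)
      fix N assume "N \<ge> max N1 N2"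
      then have N: "N \<ge> N1" "N \<ge> N2" by auto
      define A where "A = (\<Sum>n<N. w H n) / of_nat N"
      define U where "U = (\<Sum>n<N. u n) / of_nat N"
      have "(norm A)\<^sup>2 \<le> real H + real H"
        using mean_w[of H N] N1[OF N(1)] unfolding A_def by linarith
      also have "\<dots> \<le> (2 * real m)\<^sup>2" unfolding H power2_eq_square by (simp add: algebra_simps)
      finally have A: "norm A \<le> 2 * real m" by (rule power2_le_imp_le) simp
      have "real H * norm U = norm (of_nat H * U)" by (simp add: norm_mult)
      also have "\<dots> \<le> norm A + norm (A - of_nat H * U)"
        using norm_triangle_ineq4[of A "A - of_nat H * U"] by simp
      also have "\<dots> \<le> 3 * real m"
        using A N2[OF N(2)] m1 unfolding A_def U_def by linarith
      finally have "real m * norm U \<le> 3" unfolding H power2_eq_square using m0 by (simp add: mult.assoc)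
      also have "3 < real m * e" using m e by (simp add: field_simps)
      finally show "norm ((\<Sum>n<N. u n) / of_nat N - 0) < e"
        using m0 by (simp add: U_def)
    qed
  qed
qed

section \<open>Polynomial phases\<close>

lemma cis_2pi_eq_1_iff: "cis (2 * pi * x) = 1 \<longleftrightarrow> x \<in> \<int>"
proof
  assume "cis (2 * pi * x) = 1"
  then have "cos (2 * pi * x) = 1" by (simp add: complex_eq_iff)
  then obtain n :: int where "2 * pi * x = of_int n * 2 * pi"
    by (auto simp: cos_one_2pi_int)
  then show "x \<in> \<int>" by simp
next
  assume "x \<in> \<int>"
  then show "cis (2 * pi * x) = 1" by (auto elim!: Ints_cases intro: cis_multiple_2pi)
qed

text \<open>The summands form a geometric progression with ratio \<open>z \<noteq> 1\<close>, so
  every partial sum has norm at most \<open>2 / norm (z - 1)\<close>.\<close>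

lemma mean_null_linear_phase:
  assumes "\<alpha> \<notin> \<int>"
  shows "mean_null (\<lambda>n. cis (2 * pi * (\<beta> + \<alpha> * real n)))"
  unfolding mean_null_def
proof (rule Lim_null_comparison)
  define z where "z = cis (2 * pi * \<alpha>)"
  have z: "z \<noteq> 1" using assms by (simp add: z_def cis_2pi_eq_1_iff)
  have eq: "cis (2 * pi * (\<beta> + \<alpha> * real n)) = cis (2 * pi * \<beta>) * z ^ n" for n
    by (simp add: z_def Complex.DeMoivre cis_mult algebra_simps)
  show "\<forall>\<^sub>F N in sequentially. norm ((\<Sum>n<N. cis (2 * pi * (\<beta> + \<alpha> * real n))) / of_nat N)
          \<le> (2 / norm (z - 1)) * (1 / real N)"
  proof (intro always_eventually allI)
    fix N
    have "norm (\<Sum>n<N. cis (2 * pi * (\<beta> + \<alpha> * real n))) = norm (z ^ N - 1) / norm (z - 1)"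
      using z by (simp add: eq norm_mult norm_divide geometric_sum flip: sum_distrib_left)
    also have "norm (z ^ N - 1) \<le> 2"
      using norm_triangle_ineq4[of "z ^ N" 1] by (simp add: z_def norm_power)
    finally have "norm (\<Sum>n<N. cis (2 * pi * (\<beta> + \<alpha> * real n))) \<le> 2 / norm (z - 1)"
      by (simp add: divide_right_mono)
    then show "norm ((\<Sum>n<N. cis (2 * pi * (\<beta> + \<alpha> * real n))) / of_nat N) \<le> (2 / norm (z - 1)) * (1 / real N)"
      using divide_right_mono[of _ _ "real N"] by (fastforce simp: norm_divide)
  qed
  show "(\<lambda>N. (2 / norm (z - 1)) * (1 / real N)) \<longlonglongrightarrow> 0"
    by (intro tendsto_mult_right_zero lim_1_over_n)
qed

text \<open>For \<open>P = a + x p\<close> the difference of \<open>P\<close> is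
  \<open>x D + h (p + D)\<close>, where \<open>D\<close> is the difference of \<open>p\<close>; both
  claims then follow by induction on the coefficients.\<close>

lemma coeff_difference_poly:
  fixes P :: "'a::comm_ring_1 poly"
  assumes "degree P \<le> Suc d"
  shows "degree (pcompose P [:h, 1:] - P) \<le> d \<and>
         coeff (pcompose P [:h, 1:] - P) d = of_nat (Suc d) * h * coeff P (Suc d)"
  using assms
proof (induction P arbitrary: d)
  case (pCons a p)
  let ?D = "pcompose p [:h, 1:] - p"
  have eq: "pcompose (pCons a p) [:h, 1:] - pCons a p = pCons 0 ?D + smult h (p + ?D)"
    by (simp add: pcompose_pCons algebra_simps)
  have dp: "degree p \<le> d" using pCons.prems by (cases "p = 0") auto
  show ?case
  proof (cases d)
    case 0
    with dp obtain b where p: "p = [:b:]" by (auto elim: degree_eq_zeroE)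
    show ?thesis unfolding eq by (simp add: p 0)
  next
    case (Suc f)
    have IH: "degree ?D \<le> f" "coeff ?D f = of_nat (Suc f) * h * coeff p (Suc f)"
      using pCons.IH[of f] dp Suc by auto
    have "degree (pCons 0 ?D + smult h (p + ?D)) \<le> d"
      using IH(1) dp Suc
      by (intro degree_add_le order_trans[OF degree_smult_le] order_trans[OF degree_pCons_le]) auto
    moreover have "coeff ?D (Suc f) = 0" using IH(1) by (intro coeff_eq_0) simp
    ultimately show ?thesis unfolding eq using IH(2) Suc
      by (simp add: algebra_simps)
  qed
qed simp

text \<open>Each differencing lowers the degree bound by one and multiplies the top coefficient by a
  positive integer, which preserves irrationality. Linear phases are the base case.\<close>

theorem mean_null_poly_phase:
  fixes P :: "real poly"
  assumes "degree P \<le> Suc d" "coeff P (Suc d) \<notin> \<rat>"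
  shows "mean_null (\<lambda>n. cis (2 * pi * poly P (real n)))"
  using assms
proof (induction d arbitrary: P)
  case 0
  obtain a p where p: "P = pCons a p" by (rule pCons_cases)
  with 0 have "degree p = 0" by (auto split: if_splits)
  with p obtain b where P: "P = [:a, b:]" by (auto elim: degree_eq_zeroE)
  have "b \<notin> \<int>" using 0 Ints_subset_Rats by (auto simp: P)
  from mean_null_linear_phase[OF this, of a] show ?case by (simp add: P mult_ac)
next
  case (Suc d)
  show ?case
  proof (rule van_der_Corput)
    fix h :: nat assume h: "h > 0"
    define D where "D = pcompose P [:real h, 1:] - P"
    have D: "degree D \<le> Suc d" "coeff D (Suc d) = real (Suc (Suc d) * h) * coeff P (Suc (Suc d))"
      using coeff_difference_poly[OF Suc.prems(1), of "real h"] unfolding D_def of_nat_mult by blast+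
    have "coeff D (Suc d) \<notin> \<rat>"
    proof
      assume "coeff D (Suc d) \<in> \<rat>"
      then have "coeff D (Suc d) / real (Suc (Suc d) * h) \<in> \<rat>" by (intro Rats_divide Rats_of_nat)
      moreover have "real (Suc (Suc d) * h) \<noteq> 0" using h unfolding of_nat_eq_0_iff by simp
      ultimately show False using Suc.prems(2) unfolding D(2) by (metis nonzero_mult_div_cancel_left)
    qed
    from Suc.IH[OF D(1) this]
    show "mean_null (\<lambda>n. cis (2 * pi * poly P (real (n + h))) * cnj (cis (2 * pi * poly P (real n))))"
      by (simp add: D_def poly_pcompose cis_cnj cis_mult algebra_simps)
  qed simp
qed

section \<open>Equidistribution modulo 1\<close>

text \<open>Trigonometric polynomials of period 1, generated by monomials and sums so that a
  property has to be checked only there.\<close>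

inductive trig_poly :: "(real \<Rightarrow> complex) \<Rightarrow> bool" where
  trig_monom: "trig_poly (\<lambda>t. c * cis (2 * pi * (of_int h * t)))"
| trig_add: "trig_poly f \<Longrightarrow> trig_poly g \<Longrightarrow> trig_poly (\<lambda>t. f t + g t)"

lemma trig_poly_mult:
  assumes "trig_poly f" "trig_poly g"
  shows "trig_poly (\<lambda>t. f t * g t)"
  using assms(1)
proof induction
  case (trig_monom c h)
  from assms(2) show ?case
  proof induction
    case (trig_monom d j)
    have "(\<lambda>t. c * cis (2 * pi * (of_int h * t)) * (d * cis (2 * pi * (of_int j * t)))) =
          (\<lambda>t. (c * d) * cis (2 * pi * (of_int (h + j) * t)))"
    proof
      fix t
      have "cis (2 * pi * (of_int (h + j) * t)) = cis (2 * pi * (of_int h * t)) * cis (2 * pi * (of_int j * t))"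
        unfolding cis_mult by (rule arg_cong[where f = cis]) (simp add: algebra_simps)
      then show "c * cis (2 * pi * (of_int h * t)) * (d * cis (2 * pi * (of_int j * t))) =
          (c * d) * cis (2 * pi * (of_int (h + j) * t))" by simp
    qed
    then show ?case using trig_poly.trig_monom[of "c * d" "h + j"] by simp
  next
    case (trig_add f g)
    from trig_poly.trig_add[OF trig_add.IH] show ?case by (simp add: ring_distribs)
  qed
next
  case (trig_add f g)
  from trig_poly.trig_add[OF trig_add.IH] show ?case by (simp add: ring_distribs)
qed

text \<open>Connects the polynomial functions of the real Stone-Weierstrass theorem with functions
  whose means are known. On the circle a real-linear map is a combination of
  \<open>cis \<theta>\<close> and \<open>cis (- \<theta>)\<close>.\<close>

lemma trig_poly_of_real_polynomial_function:
  assumes "real_polynomial_function g"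
  shows "trig_poly (\<lambda>t. complex_of_real (g (cis (2 * pi * t))))"
  using assms
proof induction
  case (linear g)
  interpret bounded_linear g by fact
  \<comment> \<open>These coefficients come from writing \<open>cos\<close> and \<open>sin\<close>
    through exponentials in \<open>cos \<theta> * g 1 + sin \<theta> * g \<i>\<close>.\<close>
  let ?a = "(complex_of_real (g 1) - \<i> * complex_of_real (g \<i>)) / 2"
  let ?b = "(complex_of_real (g 1) + \<i> * complex_of_real (g \<i>)) / 2"
  have "complex_of_real (g (cis \<theta>)) = ?a * cis \<theta> + ?b * cis (- \<theta>)" for \<theta>
  proof -
    have eq: "cis \<theta> = cos \<theta> *\<^sub>R 1 + sin \<theta> *\<^sub>R \<i>" by (simp add: complex_eq_iff)
    have "g (cis \<theta>) = cos \<theta> * g 1 + sin \<theta> * g \<i>"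
      by (simp only: eq add scaleR real_scaleR_def)
    then show ?thesis by (simp add: complex_eq_iff field_simps)
  qed
  then have "(\<lambda>t. complex_of_real (g (cis (2 * pi * t)))) =
     (\<lambda>t. ?a * cis (2 * pi * (of_int 1 * t)) + ?b * cis (2 * pi * (of_int (-1) * t)))"
    by simp
  moreover have "trig_poly (\<lambda>t. ?a * cis (2 * pi * (of_int 1 * t)) + ?b * cis (2 * pi * (of_int (-1) * t)))"
    by (intro trig_poly.intros)
  ultimately show ?case by (simp only:)
next
  case (const c)
  show ?case using trig_monom[of "complex_of_real c" 0] by simp
next
  case (add f g)
  from trig_add[OF add.IH] show ?case by simp
next
  case (mult f g)
  from trig_poly_mult[OF mult.IH] show ?case by simp
qed

lemma has_integral_cis:
  fixes h :: int
  assumes "h \<noteq> 0"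
  shows "((\<lambda>t. cis (2 * pi * (of_int h * t))) has_integral 0) {0..1}"
proof -
  define w where "w = 2 * pi * real_of_int h"
  have w: "w \<noteq> 0" using assms by (simp add: w_def)
  have "((\<lambda>t. cis (w * t)) has_integral (cis (w * 1) / (\<i> * of_real w) - cis (w * 0) / (\<i> * of_real w))) {0..1}"
  proof (rule fundamental_theorem_of_calculus)
    fix t
    have "((\<lambda>t. cis (w * t)) has_vector_derivative (w *\<^sub>R (\<i> * cis (w * t)))) (at t within {0..1})"
      unfolding has_vector_derivative_def
      by (rule derivative_eq_intros refl)+ (simp add: fun_eq_iff mult_ac)
    from has_vector_derivative_mult_right[OF this, of "1 / (\<i> * of_real w)"]
    show "((\<lambda>t. cis (w * t) / (\<i> * of_real w)) has_vector_derivative cis (w * t)) (at t within {0..1})"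
      using w by (simp add: scaleR_conv_of_real)
  qed simp
  moreover have "cis w = 1" using cis_2pi_eq_1_iff[of "of_int h"] by (simp add: w_def)
  ultimately show ?thesis by (simp add: w_def mult.assoc)
qed

text \<open>On a monomial, the integral and the limit of the means agree: both are \<open>c\<close>
  at frequency 0 and 0 at any other frequency. Sums inherit this.\<close>

lemma trig_poly_mean:
  fixes x :: "nat \<Rightarrow> real"
  assumes x: "\<And>h::int. h \<noteq> 0 \<Longrightarrow> mean_null (\<lambda>n. cis (2 * pi * (of_int h * x n)))"
    and "trig_poly f"
  shows "\<exists>I. (f has_integral I) {0..1} \<and> (\<lambda>N. (\<Sum>n<N. f (x n)) / of_nat N) \<longlonglongrightarrow> I"
  using assms(2)
proof induction
  case (trig_monom c h)
  show ?case
  proof (cases "h = 0")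
    case True
    have "((\<lambda>t. c) has_integral c) {0..1::real}"
      using has_integral_const_real[of c 0 1] by simp
    moreover have "(\<lambda>N. (\<Sum>n<N. c) / of_nat N) \<longlonglongrightarrow> c"
      by (intro tendsto_eventually eventually_mono[OF eventually_gt_at_top[of 0]]) simp
    ultimately show ?thesis using True by auto
  next
    case False
    from has_integral_mult_right[OF has_integral_cis[OF this], of c] mean_null_cmult[OF x[OF False], of c]
    show ?thesis unfolding mean_null_def by (intro exI[of _ 0]) simp
  qed
next
  case (trig_add f g)
  then obtain I J where "(f has_integral I) {0..1}" "(\<lambda>N. (\<Sum>n<N. f (x n)) / of_nat N) \<longlonglongrightarrow> I"
    "(g has_integral J) {0..1}" "(\<lambda>N. (\<Sum>n<N. g (x n)) / of_nat N) \<longlonglongrightarrow> J" by blast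
  from has_integral_add[OF this(1,3)] tendsto_add[OF this(2,4)] show ?case
    by (intro exI[of _ "I + J"]) (simp add: sum.distrib add_divide_distrib)
qed

section \<open>From continuous functions to arcs\<close>

text \<open>Replacing \<open>f\<close> by a uniformly close polynomial \<open>g\<close> costs at
  most \<open>e / 4\<close> in the mean and in the integral; the mean of \<open>g\<close> is
  eventually within \<open>e / 4\<close> of its integral.\<close>

lemma continuous_mean:
  fixes x :: "nat \<Rightarrow> real" and f :: "complex \<Rightarrow> real"
  assumes x: "\<And>h::int. h \<noteq> 0 \<Longrightarrow> mean_null (\<lambda>n. cis (2 * pi * (of_int h * x n)))"
    and f: "continuous_on (sphere 0 1) f"
  shows "(\<lambda>N. (\<Sum>n<N. f (cis (2 * pi * x n))) / real N) \<longlonglongrightarrow> integral {0..1} (\<lambda>t. f (cis (2 * pi * t)))"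
proof (rule LIMSEQ_I)
  fix e :: real assume e: "e > 0"
  obtain g where g: "real_polynomial_function g" "\<And>z. z \<in> sphere 0 1 \<Longrightarrow> \<bar>f z - g z\<bar> < e / 4"
    using Stone_Weierstrass_real_polynomial_function[OF compact_sphere f, of "e / 4"] e by auto
  obtain I where I: "((\<lambda>t. complex_of_real (g (cis (2 * pi * t)))) has_integral I) {0..1}"
    "(\<lambda>N. (\<Sum>n<N. complex_of_real (g (cis (2 * pi * x n)))) / of_nat N) \<longlonglongrightarrow> I"
    using trig_poly_mean[OF x trig_poly_of_real_polynomial_function[OF g(1)]] by blast
  have Ig: "((\<lambda>t. g (cis (2 * pi * t))) has_integral Re I) {0..1}"
    using has_integral_linear[OF I(1) bounded_linear_Re] by (simp add: o_def)
  have "(\<lambda>N. Re ((\<Sum>n<N. complex_of_real (g (cis (2 * pi * x n)))) / of_nat N)) \<longlonglongrightarrow> Re I"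
    by (intro tendsto_Re I)
  also have "(\<lambda>N. Re ((\<Sum>n<N. complex_of_real (g (cis (2 * pi * x n)))) / of_nat N)) =
             (\<lambda>N. (\<Sum>n<N. g (cis (2 * pi * x n))) / real N)"
    by (simp add: Re_divide_of_nat)
  finally have lim: "(\<lambda>N. (\<Sum>n<N. g (cis (2 * pi * x n))) / real N) \<longlonglongrightarrow> Re I" .
  have "\<exists>no. \<forall>N\<ge>no. norm ((\<Sum>n<N. g (cis (2 * pi * x n))) / real N - Re I) < e / 4"
    using e by (intro LIMSEQ_D[OF lim]) simp
  then obtain N0 where N0: "\<bar>(\<Sum>n<N. g (cis (2 * pi * x n))) / real N - Re I\<bar> < e / 4" if "N \<ge> N0" for N
    unfolding real_norm_def by blast
  have "continuous_on {0..1} (\<lambda>t. f (cis (2 * pi * t)))"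
    by (rule continuous_on_compose2[OF f]) (auto intro!: continuous_intros)
  then have If: "((\<lambda>t. f (cis (2 * pi * t))) has_integral integral {0..1} (\<lambda>t. f (cis (2 * pi * t)))) {0..1}"
    by (intro integrable_integral integrable_continuous_real)
  have "norm (integral {0..1} (\<lambda>t. f (cis (2 * pi * t))) - Re I) \<le> e / 4 * measure lborel (cbox 0 (1::real))"
    by (rule has_integral_bound[of _ "\<lambda>t. f (cis (2 * pi * t)) - g (cis (2 * pi * t))"])
      (use e g(2) has_integral_diff[OF If Ig] in \<open>auto simp: less_imp_le\<close>)
  then have int_diff: "\<bar>integral {0..1} (\<lambda>t. f (cis (2 * pi * t))) - Re I\<bar> \<le> e / 4" by simp
  show "\<exists>no. \<forall>N\<ge>no. norm ((\<Sum>n<N. f (cis (2 * pi * x n))) / real N - integral {0..1} (\<lambda>t. f (cis (2 * pi * t)))) < e"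
  proof (intro exI[of _ "Suc N0"] allI impI)
    fix N assume N: "N \<ge> Suc N0"
    have "\<bar>\<Sum>n<N. f (cis (2 * pi * x n)) - g (cis (2 * pi * x n))\<bar> \<le> (\<Sum>n<N. e / 4)"
      by (intro order_trans[OF sum_abs] sum_mono less_imp_le g(2)) simp
    then have "\<bar>(\<Sum>n<N. f (cis (2 * pi * x n)) - g (cis (2 * pi * x n))) / real N\<bar> \<le> e / 4"
      using N by (simp add: field_simps)
    then have "\<bar>(\<Sum>n<N. f (cis (2 * pi * x n))) / real N - (\<Sum>n<N. g (cis (2 * pi * x n))) / real N\<bar> \<le> e / 4"
      by (simp add: sum_subtractf diff_divide_distrib)
    moreover have "\<bar>(\<Sum>n<N. g (cis (2 * pi * x n))) / real N - Re I\<bar> < e / 4" using N by (intro N0) simp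
    ultimately show "norm ((\<Sum>n<N. f (cis (2 * pi * x n))) / real N - integral {0..1} (\<lambda>t. f (cis (2 * pi * t)))) < e"
      using int_diff e unfolding real_norm_def by linarith
  qed
qed

text \<open>A continuous function above the indicator of the arc, with integral below
  \<open>q - p + e\<close>, bounds the counting frequency from above.\<close>

lemma arc_upper_density:
  fixes x :: "nat \<Rightarrow> real" and p q :: real
  assumes x: "\<And>h::int. h \<noteq> 0 \<Longrightarrow> mean_null (\<lambda>n. cis (2 * pi * (of_int h * x n)))"
    and pq: "0 \<le> p" "p \<le> q" "q \<le> 1" and e: "e > 0"
  shows "\<forall>\<^sub>F N in sequentially. real (card {n \<in> {..<N}. frac (x n) \<in> {p..q}}) / real N < q - p + e"
proof -
  define A where "A = (\<lambda>t. cis (2 * pi * t)) ` {p..q}"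
  have A: "closed A" "A \<noteq> {}"
    unfolding A_def using pq by (auto intro!: compact_imp_closed compact_continuous_image continuous_intros)
  \<comment> \<open>Continuous functions decreasing to the indicator of the closed arc.\<close>
  define f where "f m z = max 0 (1 - real m * infdist z A)" for m z
  have cont: "continuous_on S (f m)" for S m
    unfolding f_def by (intro continuous_intros)
  have f1: "f m z = 1" if "z \<in> A" for m z using that by (simp add: f_def)
  have f_nonneg: "f m z \<ge> 0" and f_le1: "f m z \<le> 1" for m z
    using infdist_nonneg[of z A] by (auto simp: f_def)
  have flim: "(\<lambda>m. f m z) \<longlonglongrightarrow> indicator A z" for z
  proof (cases "z \<in> A")
    case False
    \<comment> \<open>Off the closed arc the distance is positive, so \<open>f m z\<close> vanishes
      once \<open>m\<close> exceeds its reciprocal.\<close>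
    then have "infdist z A > 0"
      using A infdist_nonneg[of z A] in_closed_iff_infdist_zero[of A z] by linarith
    moreover obtain m0 where "1 < real m0 * infdist z A"
      using reals_Archimedean3[OF calculation] by blast
    ultimately have "\<forall>m\<ge>m0. f m z = 0"
      by (auto simp: f_def max_def not_le intro: order.strict_trans2 mult_right_mono)
         (meson infdist_nonneg mult_right_mono of_nat_mono order_less_le_trans not_less less_imp_le)
    then show ?thesis using False
      by (auto intro!: tendsto_eventually eventually_sequentiallyI[of m0])
  qed (simp add: f1)
  have ind: "((\<lambda>t. indicator A (cis (2 * pi * t)) :: real) has_integral (q - p)) {0..1}"
  proof (rule has_integral_spike_finite[of "{0, 1}"])
    show "((\<lambda>t. if t \<in> {p..q} then 1 else 0) has_integral (q - p)) {0..1}"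
      using has_integral_const_real[of "1::real" p q] pq by (subst has_integral_restrict) auto
    \<comment> \<open>The endpoints \<open>0\<close> and \<open>1\<close> are left out because they
      are mapped to the same point of the circle.\<close>
    fix t :: real assume t: "t \<in> {0..1} - {0, 1}"
    have "cis (2 * pi * t) \<in> A \<longleftrightarrow> t \<in> {p..q}"
    proof
      assume "cis (2 * pi * t) \<in> A"
      then obtain s where s: "s \<in> {p..q}" "cis (2 * pi * t) = cis (2 * pi * s)" by (auto simp: A_def)
      have "cis (2 * pi * (t - s)) = 1"
        using s(2) cis_divide[of "2 * pi * t" "2 * pi * s"] by (simp add: algebra_simps)
      then obtain j where "t - s = of_int j" unfolding cis_2pi_eq_1_iff by (auto elim: Ints_cases)
      \<comment> \<open>An interior \<open>t\<close> and an \<open>s\<close> in the closed unit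
        interval differ by less than 1, so an integral difference must be 0.\<close>
      moreover have "\<bar>t - s\<bar> < 1" using t s(1) pq by auto
      ultimately have "\<bar>j\<bar> < 1" by linarith
      with \<open>t - s = of_int j\<close> have "t = s" by simp
      with s show "t \<in> {p..q}" by simp
    qed (auto simp: A_def)
    then show "indicator A (cis (2 * pi * t)) = (if t \<in> {p..q} then 1 else (0::real))" by simp
  qed simp
  have "(\<lambda>m. integral {0..1} (\<lambda>t. f m (cis (2 * pi * t)))) \<longlonglongrightarrow> integral {0..1} (\<lambda>t. indicator A (cis (2 * pi * t)))"
  proof (rule dominated_convergence(2)[where h = "\<lambda>_. 1"])
    fix m
    have "continuous_on {0..1} (\<lambda>t. f m (cis (2 * pi * t)))"
      by (rule continuous_on_compose2[OF cont]) (auto intro!: continuous_intros)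
    then show "(\<lambda>t. f m (cis (2 * pi * t))) integrable_on {0..1}" by (rule integrable_continuous_real)
  qed (use f_nonneg f_le1 flim in auto)
  then have "(\<lambda>m. integral {0..1} (\<lambda>t. f m (cis (2 * pi * t)))) \<longlonglongrightarrow> q - p"
    using ind by (simp add: integral_unique)
  then have "\<forall>\<^sub>F m in sequentially. integral {0..1} (\<lambda>t. f m (cis (2 * pi * t))) < q - p + e"
    using e by (intro order_tendstoD) auto
  then obtain m where m: "integral {0..1} (\<lambda>t. f m (cis (2 * pi * t))) < q - p + e"
    using eventually_happens'[OF sequentially_bot] by blast
  have "\<forall>\<^sub>F N in sequentially. (\<Sum>n<N. f m (cis (2 * pi * x n))) / real N < q - p + e"
    using continuous_mean[OF x cont] m by (intro order_tendstoD) auto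
  then show ?thesis
  proof (rule eventually_mono)
    fix N assume N: "(\<Sum>n<N. f m (cis (2 * pi * x n))) / real N < q - p + e"
    have "real (card {n \<in> {..<N}. frac (x n) \<in> {p..q}}) = (\<Sum>n<N. if frac (x n) \<in> {p..q} then 1 else 0)"
      by (simp add: sum.If_cases Int_def)
    also have "\<dots> \<le> (\<Sum>n<N. f m (cis (2 * pi * x n)))"
    proof (rule sum_mono)
      fix n
      have "cis (2 * pi * x n) = cis (2 * pi * frac (x n))"
      proof -
        have "cis (2 * pi * frac (x n)) = cis (2 * pi * x n) / cis (2 * pi * of_int \<lfloor>x n\<rfloor>)"
          unfolding cis_divide by (rule arg_cong[where f = cis]) (simp add: frac_def algebra_simps)
        then show ?thesis using cis_2pi_eq_1_iff[of "of_int \<lfloor>x n\<rfloor>"] by simp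
      qed
      then have "frac (x n) \<in> {p..q} \<Longrightarrow> cis (2 * pi * x n) \<in> A" by (auto simp: A_def)
      then show "(if frac (x n) \<in> {p..q} then 1 else 0) \<le> f m (cis (2 * pi * x n))"
        using f1 f_nonneg by auto
    qed
    finally have "real (card {n \<in> {..<N}. frac (x n) \<in> {p..q}}) / real N \<le> (\<Sum>n<N. f m (cis (2 * pi * x n))) / real N"
      by (intro divide_right_mono) auto
    with N show "real (card {n \<in> {..<N}. frac (x n) \<in> {p..q}}) / real N < q - p + e" by linarith
  qed
qed

text \<open>The lower bound comes from the upper bound for the complementary arc.\<close>

theorem Weyl_criterion:
  fixes x :: "nat \<Rightarrow> real"
  assumes x: "\<And>h::int. h \<noteq> 0 \<Longrightarrow> mean_null (\<lambda>n. cis (2 * pi * (of_int h * x n)))"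
    and s: "0 \<le> s" "s \<le> 1"
  shows "(\<lambda>N. real (card {n \<in> {..<N}. frac (x n) < s}) / real N) \<longlonglongrightarrow> s"
proof (rule order_tendstoI)
  fix a assume "a > s"
  with arc_upper_density[OF x, of 0 s "a - s"] s
  have "\<forall>\<^sub>F N in sequentially. real (card {n \<in> {..<N}. frac (x n) \<in> {0..s}}) / real N < a" by simp
  then show "\<forall>\<^sub>F N in sequentially. real (card {n \<in> {..<N}. frac (x n) < s}) / real N < a"
  proof (rule eventually_mono)
    fix N assume N: "real (card {n \<in> {..<N}. frac (x n) \<in> {0..s}}) / real N < a"
    have "card {n \<in> {..<N}. frac (x n) < s} \<le> card {n \<in> {..<N}. frac (x n) \<in> {0..s}}"
      by (intro card_mono) auto
    then have "real (card {n \<in> {..<N}. frac (x n) < s}) / real N \<le> real (card {n \<in> {..<N}. frac (x n) \<in> {0..s}}) / real N"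
      by (intro divide_right_mono) auto
    with N show "real (card {n \<in> {..<N}. frac (x n) < s}) / real N < a" by linarith
  qed
next
  fix a assume "a < s"
  with arc_upper_density[OF x, of s 1 "s - a"] s
  have "\<forall>\<^sub>F N in sequentially. real (card {n \<in> {..<N}. frac (x n) \<in> {s..1}}) / real N < 1 - a" by simp
  with eventually_gt_at_top[of 0]
  show "\<forall>\<^sub>F N in sequentially. a < real (card {n \<in> {..<N}. frac (x n) < s}) / real N"
  proof eventually_elim
    case (elim N)
    have "{..<N} = {n \<in> {..<N}. frac (x n) < s} \<union> {n \<in> {..<N}. frac (x n) \<in> {s..1}}"
      using frac_lt_1 less_imp_le by (auto simp: not_less)
    then have "card {..<N} \<le> card {n \<in> {..<N}. frac (x n) < s} + card {n \<in> {..<N}. frac (x n) \<in> {s..1}}"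
      by (metis (no_types, lifting) card_Un_le)
    then have "real N \<le> real (card {n \<in> {..<N}. frac (x n) < s}) + real (card {n \<in> {..<N}. frac (x n) \<in> {s..1}})"
      by simp
    then show ?case using elim by (simp add: field_simps)
  qed
qed

section \<open>Linear recurrences and their characteristic polynomials\<close>

text \<open>The operator \<open>p(E)\<close> for the shift \<open>E\<close>, where
  \<open>(E a) n = a (n + 1)\<close>. The recurrence with characteristic polynomial \<open>p\<close>
  says that \<open>p(E)\<close> annihilates \<open>a\<close>.\<close>

definition lin_op :: "'a::comm_ring_1 poly \<Rightarrow> (nat \<Rightarrow> 'a) \<Rightarrow> nat \<Rightarrow> 'a" where
  "lin_op p a n = (\<Sum>i\<le>degree p. coeff p i * a (n + i))"

lemma lin_op_altdef: "degree p \<le> m \<Longrightarrow> lin_op p a n = (\<Sum>i\<le>m. coeff p i * a (n + i))"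
  unfolding lin_op_def by (rule sum.mono_neutral_left) (auto simp: coeff_eq_0)

lemma lin_op_0 [simp]: "lin_op 0 a n = 0"
  by (simp add: lin_op_def)

lemma lin_op_pCons: "lin_op (pCons c p) a n = c * a n + lin_op p a (Suc n)"
proof -
  have "lin_op (pCons c p) a n = (\<Sum>i\<le>Suc (degree p). coeff (pCons c p) i * a (n + i))"
    by (rule lin_op_altdef) (rule degree_pCons_le)
  also have "\<dots> = c * a n + (\<Sum>i\<le>degree p. coeff p i * a (Suc (n + i)))"
    by (subst sum.atMost_Suc_shift) simp
  finally show ?thesis by (simp add: lin_op_def)
qed

lemma lin_op_add: "lin_op (p + q) a n = lin_op p a n + lin_op q a n"
proof -
  let ?m = "max (degree p) (degree q)"
  have "lin_op (p + q) a n = (\<Sum>i\<le>?m. coeff (p + q) i * a (n + i))"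
    by (rule lin_op_altdef) (rule degree_add_le_max)
  then show ?thesis
    by (simp add: lin_op_altdef[of p ?m] lin_op_altdef[of q ?m] sum.distrib distrib_right)
qed

lemma lin_op_smult: "lin_op (smult c p) a n = c * lin_op p a n"
proof -
  have "lin_op (smult c p) a n = (\<Sum>i\<le>degree p. coeff (smult c p) i * a (n + i))"
    by (rule lin_op_altdef) (rule degree_smult_le)
  then show ?thesis by (simp add: lin_op_def sum_distrib_left mult.assoc)
qed

text \<open>Turns a factorisation of the characteristic polynomial into successive recurrences of
  lower order.\<close>

lemma lin_op_mult: "lin_op (p * q) a n = lin_op p (lin_op q a) n"
  by (induction p arbitrary: n) (simp_all add: lin_op_add lin_op_smult lin_op_pCons)

lemma lin_op_diff_seq: "lin_op p (\<lambda>n. a n - b n) n = lin_op p a n - lin_op p b n"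
  by (simp add: lin_op_def sum_subtractf right_diff_distrib)

text \<open>Geometric sequences are eigenvectors of the shift.\<close>

lemma lin_op_power: "lin_op p (\<lambda>n. c * x ^ n) n = c * poly p x * x ^ n"
  by (simp add: lin_op_def poly_altdef power_add sum_distrib_left sum_distrib_right mult_ac)

section \<open>Decay and asymptotics of solutions\<close>

text \<open>A contraction with vanishing perturbation forgets its starting value.\<close>

lemma first_order_decay:
  fixes x g :: "nat \<Rightarrow> 'a::real_normed_field"
  assumes rec: "\<And>n. x (Suc n) = l * x n + g n" and l: "norm l < 1" and g: "g \<longlonglongrightarrow> 0"
  shows "x \<longlonglongrightarrow> 0"
proof (rule LIMSEQ_I)
  fix e :: real assume e: "e > 0"
  \<comment> \<open>This threshold makes \<open>e / 2\<close> the fixed point of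
    \<open>y \<mapsto> norm l * y + (1 - norm l) * (e / 2)\<close>; the excess over it decays
    geometrically.\<close>
  obtain M where M: "norm (g n) < (1 - norm l) * (e / 2)" if "n \<ge> M" for n
    using LIMSEQ_D[OF g, of "(1 - norm l) * (e / 2)"] e l by auto
  have bound: "norm (x (M + j)) \<le> norm l ^ j * norm (x M) + e / 2" for j
  proof (induction j)
    case (Suc j)
    have "norm (x (M + Suc j)) \<le> norm l * norm (x (M + j)) + norm (g (M + j))"
      using norm_triangle_ineq[of "l * x (M + j)" "g (M + j)"] by (simp add: rec norm_mult)
    also have "norm l * norm (x (M + j)) \<le> norm l * (norm l ^ j * norm (x M) + e / 2)"
      by (intro mult_left_mono Suc) simp
    finally show ?case using M[of "M + j"] by (simp add: algebra_simps)
  qed (use e in simp)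
  have "(\<lambda>j. norm l ^ j * norm (x M)) \<longlonglongrightarrow> 0"
    using l by (intro tendsto_mult_left_zero LIMSEQ_power_zero) simp
  then have "\<forall>\<^sub>F j in sequentially. norm l ^ j * norm (x M) < e / 2"
    using e by (intro order_tendstoD(2)[of _ 0]) auto
  then obtain J where J: "norm l ^ j * norm (x M) < e / 2" if "j \<ge> J" for j
    unfolding eventually_sequentially by blast
  show "\<exists>no. \<forall>n\<ge>no. norm (x n - 0) < e"
  proof (intro exI[of _ "M + J"] allI impI)
    fix n assume "n \<ge> M + J"
    then have n: "M + (n - M) = n" "J \<le> n - M" by auto
    show "norm (x n - 0) < e" using bound[of "n - M"] J[OF n(2)] unfolding n(1) diff_0_right by linarith
  qed
qed

text \<open>The roots are removed one at a time. If \<open>q = (x - z) q'\<close>, then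
  \<open>q'(E) a\<close> obeys a first-order recurrence whose multiplier, after division by
  \<open>r ^ n\<close>, is \<open>z / r\<close>, of norm below 1.\<close>

lemma lin_op_decay:
  fixes q :: "complex poly" and r :: real
  assumes "q \<noteq> 0" and "\<And>z. poly q z = 0 \<Longrightarrow> norm z < r" and r: "r > 0"
    and "(\<lambda>n. lin_op q a n / of_real r ^ n) \<longlonglongrightarrow> 0"
  shows "(\<lambda>n. a n / of_real r ^ n) \<longlonglongrightarrow> 0"
  using assms(1,2,4)
proof (induction "degree q" arbitrary: q)
  case 0
  then obtain c where c: "q = [:c:]" by (auto elim: degree_eq_zeroE)
  then have "c \<noteq> 0" using 0 by auto
  note c = c this
  have "(\<lambda>n. lin_op q a n / of_real r ^ n / c) \<longlonglongrightarrow> 0 / c"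
    using c by (intro tendsto_divide 0 tendsto_const)
  then show ?case using c by (simp add: lin_op_pCons)
next
  case (Suc d)
  obtain z where z: "poly q z = 0"
    using fundamental_theorem_of_algebra[of q] Suc.hyps(2) by (auto simp: constant_degree)
  then obtain q' where q': "q = [:-z, 1:] * q'" by (auto simp: poly_eq_0_iff_dvd)
  have q'0: "q' \<noteq> 0" using Suc.prems(1) q' by auto
  have "degree q = Suc (degree q')" unfolding q' using q'0 by (subst degree_mult_eq) auto
  then have d: "d = degree q'" using Suc.hyps(2) by simp
  show ?case
  proof (rule Suc.hyps(1)[OF d q'0])
    show "norm w < r" if "poly q' w = 0" for w using that Suc.prems(2)[of w] by (simp add: q')
    define e where "e = lin_op q' a"
    have e: "e (Suc n) = z * e n + lin_op q a n" for n
      unfolding q' lin_op_mult by (simp add: e_def lin_op_pCons)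
    have "(\<lambda>n. e n / of_real r ^ n) \<longlonglongrightarrow> 0"
    proof (rule first_order_decay)
      show "e (Suc n) / of_real r ^ Suc n =
          (z / of_real r) * (e n / of_real r ^ n) + (lin_op q a n / of_real r ^ n) / of_real r" for n
        using r by (simp add: e field_simps)
      show "norm (z / of_real r) < 1" using Suc.prems(2)[OF z] r by (simp add: norm_divide)
      show "(\<lambda>n. (lin_op q a n / of_real r ^ n) / of_real r) \<longlonglongrightarrow> 0"
        using tendsto_divide[OF Suc.prems(3) tendsto_const[of "of_real r"]] r by simp
    qed
    then show "(\<lambda>n. lin_op q' a n / of_real r ^ n) \<longlonglongrightarrow> 0" by (simp add: e_def)
  qed
qed

text \<open>Since \<open>q(E) a\<close> is a multiple of \<open>\<rho> ^ n\<close>, subtracting a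
  suitable geometric term from \<open>a\<close> leaves a sequence annihilated by
  \<open>q(E)\<close>. The radius \<open>r\<close> is kept apart from \<open>\<rho>\<close>: it is
  \<open>\<rho>\<close> itself for a dominant root and 1 for an isolated one.\<close>

lemma recurrence_asymptotics:
  fixes q :: "complex poly" and r \<rho> :: real
  assumes q\<rho>: "poly q \<rho> \<noteq> 0" and roots: "\<And>z. poly q z = 0 \<Longrightarrow> norm z < r" and r: "r > 0"
    and rec: "\<And>n. lin_op ([:-of_real \<rho>, 1:] * q) a n = 0"
  obtains K where "(\<lambda>n. (a n - K * of_real \<rho> ^ n) / of_real r ^ n) \<longlonglongrightarrow> 0"
proof -
  define e where "e = lin_op q a"
  have "e (Suc n) = of_real \<rho> * e n" for n
    using rec[of n] unfolding lin_op_mult by (simp add: e_def lin_op_pCons)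
  then have e: "e n = e 0 * of_real \<rho> ^ n" for n by (induction n) auto
  \<comment> \<open>\<open>q(E)\<close> multiplies \<open>\<rho> ^ n\<close> by
    \<open>poly q \<rho>\<close>, which dictates this value.\<close>
  define K where "K = e 0 / poly q \<rho>"
  have zero: "lin_op q (\<lambda>n. a n - K * of_real \<rho> ^ n) n = 0" for n
  proof -
    have "lin_op q (\<lambda>n. a n - K * of_real \<rho> ^ n) n = e n - K * poly q (of_real \<rho>) * of_real \<rho> ^ n"
      by (simp only: lin_op_diff_seq lin_op_power e_def)
    also have "\<dots> = e n - e 0 * of_real \<rho> ^ n" using q\<rho> by (simp add: K_def)
    also have "\<dots> = 0" using e[of n] by (simp only: diff_self)
    finally show ?thesis .
  qed
  have "q \<noteq> 0" using q\<rho> by auto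
  have "(\<lambda>n. (a n - K * of_real \<rho> ^ n) / of_real r ^ n) \<longlonglongrightarrow> 0"
    by (rule lin_op_decay[OF \<open>q \<noteq> 0\<close> roots r]) (simp_all add: zero)
  then show thesis by (rule that)
qed

section \<open>The characteristic polynomial\<close>

lemma coeff_rec_poly: "coeff (rec_poly k c) i = (if i = k then 1 else if i < k then - c i else 0)"
  by (auto simp: rec_poly_def coeff_sum)

lemma degree_rec_poly [simp]: "degree (rec_poly k c) = k"
  by (intro antisym degree_le le_degree) (auto simp: coeff_rec_poly)

lemma rec_poly_nonzero [simp]: "rec_poly k c \<noteq> 0"
  using coeff_rec_poly[of k c k] by auto

lemma poly_complex_rec_poly:
  "poly (complex_poly (rec_poly k c)) z = z ^ k - (\<Sum>j<k. of_real (c j) * z ^ j)"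
proof -
  have "poly (complex_poly (rec_poly k c)) z = (\<Sum>i\<le>k. of_real (coeff (rec_poly k c) i) * z ^ i)"
    by (simp add: poly_altdef degree_map_poly coeff_map_poly)
  also have "\<dots> = (\<Sum>i<k. of_real (coeff (rec_poly k c) i) * z ^ i) + z ^ k"
    by (simp add: coeff_rec_poly flip: lessThan_Suc_atMost)
  also have "(\<Sum>i<k. of_real (coeff (rec_poly k c) i) * z ^ i) = (\<Sum>i<k. - (of_real (c i) * z ^ i))"
    by (intro sum.cong) (auto simp: coeff_rec_poly)
  finally show ?thesis by (simp add: sum_negf)
qed

lemma poly_rec_poly: "poly (rec_poly k c) x = x ^ k - (\<Sum>j<k. c j * x ^ j)"
  by (simp add: rec_poly_def poly_monom poly_sum)

lemma lin_op_rec_poly: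
  "lin_op (complex_poly (rec_poly k c)) a n = a (n + k) - (\<Sum>j<k. of_real (c j) * a (n + j))"
proof -
  have "lin_op (complex_poly (rec_poly k c)) a n = (\<Sum>i\<le>k. of_real (coeff (rec_poly k c) i) * a (n + i))"
    by (simp add: lin_op_def degree_map_poly coeff_map_poly)
  also have "\<dots> = (\<Sum>i<k. of_real (coeff (rec_poly k c) i) * a (n + i)) + a (n + k)"
    by (simp add: coeff_rec_poly flip: lessThan_Suc_atMost)
  also have "(\<Sum>i<k. of_real (coeff (rec_poly k c) i) * a (n + i)) = (\<Sum>i<k. - (of_real (c i) * a (n + i)))"
    by (intro sum.cong) (auto simp: coeff_rec_poly)
  finally show ?thesis by (simp add: sum_negf)
qed

text \<open>The multiplicative order \<open>d\<close> of \<open>w\<close> divides every exponent in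
  \<open>S\<close>, hence their gcd 1.\<close>

lemma power_one_Gcd:
  fixes w :: "'a::{idom}"
  assumes "\<And>n. n \<in> S \<Longrightarrow> w ^ n = 1" and "Gcd S = (1::nat)" "k \<in> S" "k > 0"
  shows "w = 1"
proof -
  define d where "d = (LEAST n. n > 0 \<and> w ^ n = 1)"
  have d: "d > 0" "w ^ d = 1"
    using LeastI[of "\<lambda>n. n > 0 \<and> w ^ n = 1" k] assms by (auto simp: d_def)
  have "d dvd n" if "n \<in> S" for n
  proof (rule ccontr)
    assume "\<not> d dvd n"
    then have pos: "n mod d > 0" by (simp add: dvd_eq_mod_eq_0)
    have "w ^ n = (w ^ d) ^ (n div d) * w ^ (n mod d)"
      by (simp flip: power_mult power_add)
    then have "w ^ (n mod d) = 1" using d assms(1)[OF that] by simp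
    with pos have "d \<le> n mod d" unfolding d_def by (intro Least_le) auto
    then show False using mod_less_divisor[OF d(1), of n] by linarith
  qed
  then have "d dvd Gcd S" by (rule Gcd_greatest)
  with assms d show ?thesis by simp
qed

section \<open>Nonnegative coefficients\<close>

text \<open>Passing from \<open>\<rho>\<close> to \<open>s * \<rho>\<close> with
  \<open>s > 1\<close> multiplies the leading term by \<open>s ^ k\<close> but the term of degree
  \<open>j\<close> only by \<open>s ^ j\<close>. The positive constant term makes the inequality
  strict.\<close>

lemma nonneg_rec_poly_dominates:
  fixes \<rho> y :: real
  assumes nonneg: "\<And>i. i < k \<Longrightarrow> c i \<ge> 0" and c0: "c 0 > 0" and k: "k > 0"
    and \<rho>: "\<rho> > 0" "\<rho> ^ k = (\<Sum>j<k. c j * \<rho> ^ j)" and y: "y > \<rho>"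
  shows "(\<Sum>j<k. c j * y ^ j) < y ^ k"
proof -
  define s where "s = y / \<rho>"
  have s: "s > 1" "y = s * \<rho>" using \<rho> y by (auto simp: s_def)
  have "(\<Sum>j<k. c j * y ^ j) < (\<Sum>j<k. s ^ k * (c j * \<rho> ^ j))"
  proof (rule sum_strict_mono_ex1)
    have "s ^ j * (c j * \<rho> ^ j) \<le> s ^ k * (c j * \<rho> ^ j)" if "j < k" for j
      using that s \<rho> nonneg by (intro mult_right_mono power_increasing) auto
    then show "\<forall>j\<in>{..<k}. c j * y ^ j \<le> s ^ k * (c j * \<rho> ^ j)"
      by (auto simp: s(2) power_mult_distrib mult_ac)
    have "1 < s ^ k" using s k by (intro one_less_power)
    then show "\<exists>j\<in>{..<k}. c j * y ^ j < s ^ k * (c j * \<rho> ^ j)"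
      using c0 k by (intro bexI[of _ 0]) auto
  qed simp
  also have "\<dots> = y ^ k" using \<rho>(2) by (simp add: s(2) power_mult_distrib flip: sum_distrib_left)
  finally show ?thesis .
qed

lemma nonneg_rec_poly_pos_root:
  assumes nonneg: "\<And>i. i < k \<Longrightarrow> c i \<ge> 0" and c0: "c 0 > 0" and k: "k > 0"
  obtains \<rho> where "\<rho> > 0" "poly (rec_poly k c) \<rho> = 0"
proof -
  \<comment> \<open>At this point, which is at least 1, the lower terms sum to at most
    \<open>(x - 1) * x ^ (k - 1)\<close>, which is less than \<open>x ^ k\<close>.\<close>
  define x where "x = 1 + (\<Sum>j<k. c j)"
  have x: "x \<ge> 1" using sum_nonneg[of "{..<k}" c] nonneg by (auto simp: x_def)
  have "(\<Sum>j<k. c j * x ^ j) \<le> (\<Sum>j<k. c j * x ^ (k - 1))"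
    using x nonneg by (intro sum_mono mult_left_mono power_increasing) auto
  also have "\<dots> = (x - 1) * x ^ (k - 1)" by (simp add: x_def sum_distrib_right)
  also have "\<dots> < x * x ^ (k - 1)" using x by (intro mult_strict_right_mono) auto
  also have "\<dots> = x ^ k" using k by (cases k) auto
  finally have "poly (rec_poly k c) x > 0" by (simp add: poly_rec_poly)
  moreover have "poly (rec_poly k c) 0 < 0"
    using c0 k by (simp add: poly_0_coeff_0 coeff_rec_poly)
  ultimately show thesis using poly_IVT_pos[of 0 x "rec_poly k c"] x that by auto
qed

text \<open>Substituting the equation for \<open>\<rho> ^ k\<close> gives \<open>\<rho> * p'(\<rho>)
  = (\<Sum>j<k. (k - j) * (c j * \<rho> ^ j))\<close>, whose terms are nonnegative and whose term
  for \<open>j = 0\<close> is positive.\<close>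

lemma nonneg_rec_poly_simple_root:
  assumes nonneg: "\<And>i. i < k \<Longrightarrow> c i \<ge> 0" and c0: "c 0 > 0" and k: "k > 0"
    and \<rho>: "\<rho> > 0" "poly (rec_poly k c) \<rho> = 0"
  shows "poly (pderiv (rec_poly k c)) \<rho> \<noteq> 0"
proof -
  have "((\<lambda>x. x ^ k - (\<Sum>j<k. c j * x ^ j)) has_field_derivative
      real k * \<rho> ^ (k - 1) - (\<Sum>j<k. c j * (real j * \<rho> ^ (j - 1)))) (at \<rho>)"
    by (auto intro!: derivative_eq_intros sum.cong)
  moreover have "((\<lambda>x. x ^ k - (\<Sum>j<k. c j * x ^ j)) has_field_derivative poly (pderiv (rec_poly k c)) \<rho>) (at \<rho>)"
    using poly_DERIV[of "rec_poly k c" \<rho>] by (simp add: poly_rec_poly)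
  ultimately have "poly (pderiv (rec_poly k c)) \<rho> = real k * \<rho> ^ (k - 1) - (\<Sum>j<k. c j * (real j * \<rho> ^ (j - 1)))"
    using DERIV_unique by blast
  \<comment> \<open>The factor \<open>\<rho>\<close> restores the exponent \<open>j\<close>; for
    \<open>j = 0\<close>, where \<open>j - 1\<close> is truncated, both sides vanish.\<close>
  moreover have e: "\<rho> * (real j * \<rho> ^ (j - 1)) = real j * \<rho> ^ j" for j by (cases j) auto
  have "\<rho> * (c j * (real j * \<rho> ^ (j - 1))) = real j * (c j * \<rho> ^ j)" for j
    using e[of j] by (simp only: mult.left_commute[of _ "c j"])
  moreover have "\<rho> * (real k * \<rho> ^ (k - 1)) = real k * \<rho> ^ k" by (rule e)
  ultimately have "\<rho> * poly (pderiv (rec_poly k c)) \<rho> = real k * \<rho> ^ k - (\<Sum>j<k. real j * (c j * \<rho> ^ j))"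
    by (simp only: right_diff_distrib sum_distrib_left)
  also have "\<rho> ^ k = (\<Sum>j<k. c j * \<rho> ^ j)" using \<rho>(2) by (simp add: poly_rec_poly)
  also have "real k * \<dots> - (\<Sum>j<k. real j * (c j * \<rho> ^ j)) = (\<Sum>j<k. (real k - real j) * (c j * \<rho> ^ j))"
    by (simp add: sum_distrib_left left_diff_distrib sum_subtractf)
  also have "\<dots> > 0"
    using nonneg c0 k \<rho> by (intro sum_pos2[of _ 0]) auto
  finally show ?thesis by auto
qed

lemma nonneg_rec_poly_max_modulus_root:
  fixes \<zeta> :: complex
  assumes nonneg: "\<And>i. i < k \<Longrightarrow> c i \<ge> 0" and c0: "c 0 > 0" and k: "k > 0"
    and gcd: "Gcd (inner_support k c \<union> {k}) = 1"
    and \<rho>: "\<rho> > 0" "poly (rec_poly k c) \<rho> = 0"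
    and \<zeta>: "poly (complex_poly (rec_poly k c)) \<zeta> = 0" "norm \<zeta> \<ge> \<rho>"
  shows "\<zeta> = of_real \<rho>"
proof -
  have \<rho>_eq: "\<rho> ^ k = (\<Sum>j<k. c j * \<rho> ^ j)" using \<rho>(2) by (simp add: poly_rec_poly)
  have \<zeta>_eq: "\<zeta> ^ k = (\<Sum>j<k. of_real (c j) * \<zeta> ^ j)" using \<zeta>(1) by (simp add: poly_complex_rec_poly)
  have "norm \<zeta> ^ k = norm (\<Sum>j<k. of_real (c j) * \<zeta> ^ j)" by (simp add: norm_power flip: \<zeta>_eq)
  also have "\<dots> \<le> (\<Sum>j<k. c j * norm \<zeta> ^ j)"
    by (rule order_trans[OF norm_sum]) (use nonneg in \<open>auto intro!: sum_mono simp: norm_mult norm_power\<close>)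
  finally have "\<not> norm \<zeta> > \<rho>"
    using nonneg_rec_poly_dominates[of k c, OF nonneg c0 k \<rho>(1) \<rho>_eq, of "norm \<zeta>"] by linarith
  then have norm_eq: "norm \<zeta> = \<rho>" using \<zeta>(2) by simp
  define w where "w = \<zeta> / of_real \<rho>"
  have w: "norm w = 1" "\<zeta> = w * of_real \<rho>" using \<rho> norm_eq by (auto simp: w_def norm_divide)
  have ww: "w ^ n * cnj (w ^ n) = 1" for n
    using complex_norm_square[of "w ^ n"] w(1) by (simp add: norm_power)
  \<comment> \<open>\<open>v j\<close> is the direction of the \<open>j\<close>-th term of the sum
    relative to that of \<open>\<zeta> ^ k\<close>.\<close>
  define v where "v j = w ^ j * cnj (w ^ k)" for j
  have v1: "norm (v j) = 1" for j by (simp add: v_def norm_mult norm_power w)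
  \<comment> \<open>Equality in the triangle inequality: all nonzero terms of the sum point in the direction of \<open>\<zeta>\<^sup>k\<close>.\<close>
  have "(\<Sum>j<k. of_real (c j * \<rho> ^ j) * v j) = \<zeta> ^ k * cnj (w ^ k)"
    unfolding \<zeta>_eq v_def by (simp add: w(2) sum_distrib_left sum_distrib_right power_mult_distrib mult_ac)
  also have "\<dots> = of_real (\<rho> ^ k)" using ww[of k] by (simp add: w(2) power_mult_distrib mult_ac)
  finally have "Re (\<Sum>j<k. of_real (c j * \<rho> ^ j) * v j) = \<rho> ^ k" by simp
  then have "(\<Sum>j<k. c j * \<rho> ^ j * Re (v j)) = (\<Sum>j<k. c j * \<rho> ^ j)" by (simp add: \<rho>_eq)
  then have "(\<Sum>j<k. c j * \<rho> ^ j * (1 - Re (v j))) = 0"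
    by (simp add: right_diff_distrib sum_subtractf)
  moreover have "Re (v j) \<le> 1" for j using complex_Re_le_cmod[of "v j"] v1[of j] by simp
  ultimately have zero: "\<forall>j\<in>{..<k}. c j * \<rho> ^ j * (1 - Re (v j)) = 0"
    using nonneg \<rho>(1) by (subst (asm) sum_nonneg_eq_0_iff) auto
  have wj: "w ^ j = w ^ k" if j: "j < k" "c j \<noteq> 0" for j
  proof -
    have "Re (v j) = 1" using zero j \<rho>(1) by auto
    moreover from this have "Im (v j) = 0" using v1[of j] cmod_power2[of "v j"] by simp
    ultimately have "v j = 1" by (simp add: complex_eq_iff)
    then have "w ^ k = w ^ j * (w ^ k * cnj (w ^ k))" by (simp add: v_def mult_ac)
    then show ?thesis by (simp only: ww mult_1_right)
  qed
  \<comment> \<open>Since \<open>c 0 > 0\<close>, the index 0 is among those with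
    \<open>w ^ j = w ^ k\<close>.\<close>
  have "w ^ k = 1" using wj[of 0] k c0 by simp
  then have "w ^ n = 1" if "n \<in> inner_support k c \<union> {k}" for n
    using that wj[of n] k by (auto simp: inner_support_def)
  then have "w = 1" by (rule power_one_Gcd[OF _ gcd, of _ k]) (use k in auto)
  then show ?thesis by (simp add: w)
qed

section \<open>Dominant roots and linear factors\<close>

lemma poly_complex_poly_of_real: "poly (complex_poly p) (of_real x) = of_real (poly p x)"
  by (simp add: poly_altdef degree_map_poly coeff_map_poly)

lemma complex_poly_mult: "complex_poly (p * q) = complex_poly p * complex_poly q"
  by (intro poly_eqI) (simp add: coeff_map_poly coeff_mult)

text \<open>Deleting one copy of \<open>\<rho>\<close> from the multiset of zeros leaves exactly the
  zeros of the cofactor. Hence \<open>\<rho>\<close> is not a zero of the cofactor, as its modulus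
  is not below \<open>\<rho>\<close>.\<close>

lemma dominant_root_factor:
  assumes "dominant_root p \<rho>" "p \<noteq> 0"
  obtains q where "complex_poly p = [:-of_real \<rho>, 1:] * q" "poly q (of_real \<rho>) \<noteq> 0"
    "\<And>z. poly q z = 0 \<Longrightarrow> norm z < \<rho>"
proof -
  have dom: "\<rho> > 0" "poly p \<rho> = 0"
    "\<And>\<zeta>. \<zeta> \<in># proots (complex_poly p) - {#of_real \<rho>#} \<Longrightarrow> norm \<zeta> < \<rho>"
    using assms(1) by (auto simp: dominant_root_def)
  have "poly (complex_poly p) (of_real \<rho>) = 0" using dom(2) by (simp add: poly_complex_poly_of_real)
  then obtain q where q: "complex_poly p = [:-of_real \<rho>, 1:] * q" by (auto simp: poly_eq_0_iff_dvd)
  have q0: "q \<noteq> 0" using assms(2) q by (auto simp: map_poly_eq_0_iff)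
  have "proots (complex_poly p) = {#of_real \<rho>#} + proots q"
    unfolding q using q0 by (subst proots_mult) auto
  then have roots: "norm z < \<rho>" if "poly q z = 0" for z
    using that q0 dom(3)[of z] by simp
  then have "poly q (of_real \<rho>) \<noteq> 0" using dom(1) roots[of "of_real \<rho>"] by auto
  with q roots show thesis by (intro that) auto
qed

text \<open>The nonzero derivative keeps \<open>\<rho>\<close> out of the zeros of the cofactor, so
  the bound for zeros different from \<open>\<rho>\<close> covers the whole remaining
  multiset.\<close>

lemma dominant_rootI:
  assumes "\<rho> > 0" "poly p \<rho> = 0" "poly (pderiv p) \<rho> \<noteq> 0"
    and "\<And>x. x > 0 \<Longrightarrow> poly p x = 0 \<Longrightarrow> x = \<rho>"
    and other: "\<And>\<zeta>. poly (complex_poly p) \<zeta> = 0 \<Longrightarrow> \<zeta> \<noteq> of_real \<rho> \<Longrightarrow> norm \<zeta> < \<rho>"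
  shows "dominant_root p \<rho>"
proof -
  obtain q where q: "p = [:-\<rho>, 1:] * q" using assms(2) by (auto simp: poly_eq_0_iff_dvd)
  have q\<rho>: "poly q \<rho> \<noteq> 0" using assms(3) unfolding q pderiv_mult by (simp add: pderiv_pCons)
  have cq: "complex_poly p = [:-of_real \<rho>, 1:] * complex_poly q"
    unfolding q by (simp only: complex_poly_mult) (simp add: map_poly_pCons)
  have q0: "complex_poly q \<noteq> 0" using q\<rho> by (auto simp: map_poly_eq_0_iff)
  have "proots (complex_poly p) - {#of_real \<rho>#} = proots (complex_poly q)"
    unfolding cq using q0 by (subst proots_mult) auto
  moreover have "norm \<zeta> < \<rho>" if "poly (complex_poly q) \<zeta> = 0" for \<zeta>
  proof (rule other)
    show "poly (complex_poly p) \<zeta> = 0" unfolding cq using that by simp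
    show "\<zeta> \<noteq> of_real \<rho>" using that q\<rho> by (metis poly_complex_poly_of_real of_real_eq_0_iff)
  qed
  ultimately have "\<forall>\<zeta>\<in>#proots (complex_poly p) - {#of_real \<rho>#}. norm \<zeta> < \<rho>"
    using q0 by simp
  with assms(1,2,4) show ?thesis unfolding dominant_root_def by blast
qed

text \<open>If \<open>D\<close> divides \<open>k\<close> and every exponent with nonzero
  coefficient, rotating \<open>\<rho>\<close> by a \<open>D\<close>-th root of unity gives another
  zero of the same modulus, so dominance forces \<open>D = 1\<close>. The converse collects
  existence, simplicity, uniqueness and maximal modulus.\<close>

lemma nonneg_rec_poly_dominant_root_iff:
  assumes nonneg: "\<And>i. i < k \<Longrightarrow> c i \<ge> 0" and c0: "c 0 > 0" and k: "k > 0"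
  shows "(\<exists>\<rho>. dominant_root (rec_poly k c) \<rho>) \<longleftrightarrow> Gcd (inner_support k c \<union> {k}) = 1"
proof
  assume "\<exists>\<rho>. dominant_root (rec_poly k c) \<rho>"
  then obtain \<rho> where dom: "dominant_root (rec_poly k c) \<rho>" ..
  then have \<rho>: "\<rho> > 0" "poly (rec_poly k c) \<rho> = 0" by (auto simp: dominant_root_def)
  define D where "D = Gcd (inner_support k c \<union> {k})"
  define w where "w = cis (2 * pi / real D)"
  have "D \<noteq> 0" using k by (simp add: D_def)
  have "D dvd j" if "j < k" "c j \<noteq> 0" for j
  proof (cases "j = 0")
    \<comment> \<open>The index 0 lies outside \<open>inner_support\<close>, but \<open>D\<close>
      divides it anyway.\<close>
    case False
    then show ?thesis unfolding D_def using that by (intro Gcd_dvd) (auto simp: inner_support_def)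
  qed simp
  moreover have "D dvd k" unfolding D_def by (intro Gcd_dvd) simp
  moreover have "w ^ D = 1" using \<open>D \<noteq> 0\<close> by (simp add: w_def Complex.DeMoivre)
  then have pow: "w ^ j = 1" if "D dvd j" for j using that by (auto elim!: dvdE simp: power_mult)
  ultimately have wk: "w ^ k = 1" and wj: "\<And>j. j < k \<Longrightarrow> c j \<noteq> 0 \<Longrightarrow> w ^ j = 1"
    by blast+
  obtain q where q: "complex_poly (rec_poly k c) = [:-of_real \<rho>, 1:] * q" "poly q (of_real \<rho>) \<noteq> 0"
    "\<And>z. poly q z = 0 \<Longrightarrow> norm z < \<rho>"
    using dominant_root_factor[OF dom] by auto
  have "poly (complex_poly (rec_poly k c)) (of_real \<rho> * w) = of_real (poly (rec_poly k c) \<rho>)"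
  proof -
    have "(\<Sum>j<k. of_real (c j) * (of_real \<rho> * w) ^ j) = (\<Sum>j<k. complex_of_real (c j) * of_real \<rho> ^ j)"
    proof (rule sum.cong)
      show "of_real (c j) * (of_real \<rho> * w) ^ j = complex_of_real (c j) * of_real \<rho> ^ j" if "j \<in> {..<k}" for j
        using that wj[of j] by (cases "c j = 0") (simp_all add: power_mult_distrib)
    qed simp
    then show ?thesis unfolding poly_complex_rec_poly poly_rec_poly by (simp add: power_mult_distrib wk)
  qed
  then have "of_real \<rho> * w = of_real \<rho> \<or> poly q (of_real \<rho> * w) = 0"
    using \<rho>(2) by (auto simp: q)
  moreover have "norm (of_real \<rho> * w) = \<rho>" using \<rho>(1) by (simp add: w_def norm_mult)
  ultimately have "w = 1" using \<rho>(1) q(3)[of "of_real \<rho> * w"] by auto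
  show "Gcd (inner_support k c \<union> {k}) = 1"
  proof (rule ccontr)
    assume "Gcd (inner_support k c \<union> {k}) \<noteq> 1"
    then have "D \<ge> 2" using \<open>D \<noteq> 0\<close> unfolding D_def by linarith
    have "cos (2 * pi / real D) = 1" using \<open>w = 1\<close> by (simp add: w_def complex_eq_iff)
    then obtain n :: int where "2 * pi / real D = of_int n * 2 * pi" by (auto simp: cos_one_2pi_int)
    then have "(2 * pi) * (1 / real D) = (2 * pi) * of_int n" by simp
    then have "1 / real D = of_int n" unfolding mult_cancel_left by simp
    then have "real D * of_int n = 1" using \<open>D \<noteq> 0\<close> by (simp add: field_simps)
    then have "int D * n = 1" by (metis of_int_eq_iff of_int_mult of_int_of_nat_eq of_int_1)
    then show False using \<open>D \<ge> 2\<close> by (simp add: zmult_eq_1_iff)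
  qed
next
  assume gcd: "Gcd (inner_support k c \<union> {k}) = 1"
  obtain \<rho> where \<rho>: "\<rho> > 0" "poly (rec_poly k c) \<rho> = 0"
    using nonneg_rec_poly_pos_root[of k c] nonneg c0 k by blast
  have "dominant_root (rec_poly k c) \<rho>"
  proof (rule dominant_rootI[OF \<rho>])
    show "poly (pderiv (rec_poly k c)) \<rho> \<noteq> 0"
      using nonneg_rec_poly_simple_root[of k c] nonneg c0 k \<rho> by blast
    fix x :: real assume x: "x > 0" "poly (rec_poly k c) x = 0"
    \<comment> \<open>At the larger of two distinct positive roots the polynomial would be
      positive.\<close>
    show "x = \<rho>"
      using nonneg_rec_poly_dominates[of k c x \<rho>] nonneg_rec_poly_dominates[of k c \<rho> x] nonneg c0 k \<rho> x
      by (cases x \<rho> rule: linorder_cases) (auto simp: poly_rec_poly)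
  next
    fix \<zeta> assume "poly (complex_poly (rec_poly k c)) \<zeta> = 0" "\<zeta> \<noteq> of_real \<rho>"
    then show "norm \<zeta> < \<rho>"
      using nonneg_rec_poly_max_modulus_root[of k c \<rho> \<zeta>] nonneg c0 k gcd \<rho> not_less by blast
  qed
  then show "\<exists>\<rho>. dominant_root (rec_poly k c) \<rho>" ..
qed

section \<open>Large top coefficient\<close>

text \<open>The two leading terms decide the sign of \<open>p\<close> at \<open>d - 1\<close> and
  \<open>d + 1\<close>, which locates \<open>\<rho>\<close>. The other zeros are those of the
  cofactor, whose lower coefficients are too small for a zero outside the open unit disc.\<close>

lemma rec_poly_large_top_coeff_root:
  assumes top: "large_top_coeff (Suc (Suc m)) c"
  shows "\<exists>\<rho>. isolated_root_near (c (Suc m)) (rec_poly (Suc (Suc m)) c) \<rho>"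
proof -
  define d where "d = c (Suc m)"
  define S where "S = (\<Sum>j\<le>m. \<bar>c j\<bar>)"
  define p where "p = rec_poly (Suc (Suc m)) c"
  have d: "d \<ge> 2" "d > S + 1"
    using top by (auto simp: large_top_coeff_def d_def S_def atLeast0LessThan lessThan_Suc_atMost)
  have "S \<ge> 0" by (simp add: S_def sum_nonneg)
  define R where "R x = (\<Sum>j\<le>m. c j * x ^ j)" for x
  have p_eq: "poly p x = x ^ m * (x * (x - d)) - R x" for x
    by (simp add: p_def poly_rec_poly R_def d_def algebra_simps flip: lessThan_Suc_atMost)
  have R: "\<bar>R x\<bar> \<le> S * x ^ m" if "x \<ge> 1" for x
  proof -
    have "\<bar>R x\<bar> \<le> (\<Sum>j\<le>m. \<bar>c j * x ^ j\<bar>)" unfolding R_def by (rule sum_abs)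
    also have "\<dots> \<le> (\<Sum>j\<le>m. \<bar>c j\<bar> * x ^ m)"
      using that by (intro sum_mono) (auto simp: abs_mult intro!: mult_left_mono power_increasing)
    finally show ?thesis by (simp add: S_def sum_distrib_right)
  qed
  \<comment> \<open>At \<open>d + 1\<close> and \<open>d - 1\<close>, both at least 1, the leading
    part is \<open>x ^ Suc m\<close> up to sign, and \<open>S < x\<close> makes it outweigh
    \<open>R x\<close>.\<close>
  have "S * (d + 1) ^ m < (d + 1) * (d + 1) ^ m" using d by (intro mult_strict_right_mono) auto
  moreover have "poly p (d + 1) = (d + 1) * (d + 1) ^ m - R (d + 1)" by (simp add: p_eq)
  ultimately have pos: "poly p (d + 1) > 0" using R[of "d + 1"] d by linarith
  have "S * (d - 1) ^ m < (d - 1) * (d - 1) ^ m" using d by (intro mult_strict_right_mono) auto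
  moreover have "poly p (d - 1) = - ((d - 1) * (d - 1) ^ m) - R (d - 1)" by (simp add: p_eq algebra_simps)
  ultimately have neg: "poly p (d - 1) < 0" using R[of "d - 1"] d by linarith
  obtain \<rho> where \<rho>: "d - 1 < \<rho>" "\<rho> < d + 1" "poly p \<rho> = 0"
    using poly_IVT_pos[OF _ neg pos] by auto
  obtain q where q: "p = [:-\<rho>, 1:] * q" using \<rho>(3) by (auto simp: poly_eq_0_iff_dvd)
  have q0: "q \<noteq> 0" using q by (auto simp: p_def)
  have "degree p = Suc (degree q)" unfolding q using q0 by (subst degree_mult_eq) auto
  then have deg_q: "degree q = Suc m" by (simp add: p_def)
  have coeff_p: "coeff p (Suc i) = coeff q i - \<rho> * coeff q (Suc i)" "coeff p 0 = - \<rho> * coeff q 0" for i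
    by (simp_all add: q)
  have lead: "coeff q (Suc m) = 1"
    using coeff_p(1)[of "Suc m"] deg_q by (simp add: p_def coeff_rec_poly coeff_eq_0)
  have q_m: "coeff q m = \<rho> - d"
    using coeff_p(1)[of m] lead by (simp add: p_def coeff_rec_poly d_def)
  \<comment> \<open>By Horner's scheme \<open>\<rho> q\<^sub>i = q\<^sub>i\<^sub>-\<^sub>1 + c\<^sub>i\<close>; summing absolute values gives \<open>B < 1\<close>.\<close>
  define B where "B = (\<Sum>i\<le>m. \<bar>coeff q i\<bar>)"
  have 0: "\<rho> * \<bar>coeff q 0\<bar> = \<bar>c 0\<bar>"
    using coeff_p(2) \<rho> d by (simp add: p_def coeff_rec_poly abs_mult)
  have Suc: "\<rho> * \<bar>coeff q (Suc i)\<bar> \<le> \<bar>coeff q i\<bar> + \<bar>c (Suc i)\<bar>" if "i < m" for i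
  proof -
    have "\<rho> * coeff q (Suc i) = coeff q i + c (Suc i)"
      using coeff_p(1)[of i] that by (simp add: p_def coeff_rec_poly)
    then have "\<bar>\<rho> * coeff q (Suc i)\<bar> \<le> \<bar>coeff q i\<bar> + \<bar>c (Suc i)\<bar>" by simp
    then show ?thesis using \<rho> d by (simp add: abs_mult)
  qed
  have shift: "(\<Sum>i\<le>m. f i) = f 0 + (\<Sum>i<m. f (Suc i))" for f :: "nat \<Rightarrow> real"
    by (rule sum.atMost_shift)
  have "\<rho> * B = \<rho> * \<bar>coeff q 0\<bar> + (\<Sum>i<m. \<rho> * \<bar>coeff q (Suc i)\<bar>)"
    unfolding B_def by (subst shift) (simp add: distrib_left sum_distrib_left)
  also have "\<dots> \<le> \<bar>c 0\<bar> + (\<Sum>i<m. \<bar>coeff q i\<bar> + \<bar>c (Suc i)\<bar>)"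
    unfolding 0 using Suc by (intro add_left_mono sum_mono) simp
  also have "\<dots> = S + (\<Sum>i<m. \<bar>coeff q i\<bar>)"
    unfolding S_def by (subst shift) (simp add: sum.distrib)
  \<comment> \<open>The last term of \<open>B\<close> is \<open>\<bar>\<rho> - d\<bar>\<close>,
    because \<open>coeff q m = \<rho> - d\<close>.\<close>
  also have "\<dots> = S + (B - \<bar>\<rho> - d\<bar>)"
    by (simp add: B_def q_m flip: lessThan_Suc_atMost)
  \<comment> \<open>The chain reads
    \<open>(\<rho> - 1) * B \<le> S - \<bar>\<rho> - d\<bar>\<close>, and
    \<open>S < d - 1 \<le> \<rho> - 1 + \<bar>\<rho> - d\<bar>\<close>.\<close>
  finally have "(\<rho> - 1) * B < (\<rho> - 1) * 1" using d by (simp add: algebra_simps)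
  then have B: "B < 1" using \<rho> d by (subst (asm) mult_less_cancel_left_pos) auto
  \<comment> \<open>For \<open>norm z \<ge> 1\<close> the lower terms of \<open>q\<close> contribute
    at most \<open>B * norm z ^ m\<close>, too little to cancel the leading term.\<close>
  have roots_q: "norm z < 1" if "poly (complex_poly q) z = 0" for z
  proof (rule ccontr)
    assume "\<not> norm z < 1"
    then have z: "norm z \<ge> 1" by simp
    have "poly (complex_poly q) z = (\<Sum>i\<le>m. of_real (coeff q i) * z ^ i) + z ^ Suc m"
      by (simp add: poly_altdef degree_map_poly coeff_map_poly deg_q lead)
    then have "z ^ Suc m = - (\<Sum>i\<le>m. of_real (coeff q i) * z ^ i)"
      using that by (simp add: add_eq_0_iff)
    then have "norm z ^ Suc m = norm (\<Sum>i\<le>m. of_real (coeff q i) * z ^ i)"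
      by (metis norm_minus_cancel norm_power)
    also have "\<dots> \<le> (\<Sum>i\<le>m. \<bar>coeff q i\<bar> * norm z ^ m)"
      using z by (intro order_trans[OF norm_sum] sum_mono)
        (auto simp: norm_mult norm_power intro!: mult_left_mono power_increasing)
    also have "\<dots> = B * norm z ^ m" by (simp add: B_def sum_distrib_right)
    also have "\<dots> < 1 * norm z ^ m"
      using B z by (intro mult_strict_right_mono zero_less_power) linarith+
    also have "\<dots> \<le> norm z ^ Suc m" using power_increasing[OF _ z, of m "Suc m"] by simp
    finally show False by simp
  qed
  have "poly q \<rho> \<noteq> 0"
    using roots_q[of "of_real \<rho>"] \<rho> d by (auto simp: poly_complex_poly_of_real)
  then have "order \<rho> p = 1"
    unfolding q using q0 order_power_n_n[of \<rho> 1] by (subst order_mult) (auto simp: order_0I simp del: mult_pCons_left)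
  moreover have "norm \<zeta> < 1" if "poly (complex_poly p) \<zeta> = 0" "\<zeta> \<noteq> of_real \<rho>" for \<zeta>
  proof (rule roots_q)
    have "complex_poly p = [:-of_real \<rho>, 1:] * complex_poly q"
      unfolding q by (simp only: complex_poly_mult) (simp add: map_poly_pCons)
    then show "poly (complex_poly q) \<zeta> = 0" using that by auto
  qed
  ultimately have "isolated_root_near d p \<rho>" using \<rho> unfolding isolated_root_near_def by blast
  then show ?thesis unfolding p_def d_def ..
qed

text \<open>Order 1 means that \<open>\<rho>\<close> is not a zero of the cofactor, so every zero of
  the cofactor is among the other zeros of \<open>p\<close>.\<close>

lemma isolated_root_factor:
  assumes iso: "isolated_root_near d p \<rho>" and "p \<noteq> 0"
  obtains q where "complex_poly p = [:-of_real \<rho>, 1:] * q" "poly q (of_real \<rho>) \<noteq> 0"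
    "\<And>z. poly q z = 0 \<Longrightarrow> norm z < 1"
proof -
  have "poly p \<rho> = 0" and ord: "order \<rho> p = 1" using iso by (auto simp: isolated_root_near_def)
  then obtain q where q: "p = [:-\<rho>, 1:] * q" by (auto simp: poly_eq_0_iff_dvd)
  have "order \<rho> p = 1 + order \<rho> q"
    unfolding q using order_power_n_n[of \<rho> 1] assms(2) by (subst order_mult) (auto simp: q simp del: mult_pCons_left)
  then have "poly q \<rho> \<noteq> 0" using ord order_root[of q \<rho>] assms(2) q by auto
  then have q\<rho>: "poly (complex_poly q) (of_real \<rho>) \<noteq> 0" by (simp add: poly_complex_poly_of_real)
  have cq: "complex_poly p = [:-of_real \<rho>, 1:] * complex_poly q"
    unfolding q by (simp only: complex_poly_mult) (simp add: map_poly_pCons)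
  have "norm z < 1" if "poly (complex_poly q) z = 0" for z
  proof -
    have "poly (complex_poly p) z = 0" unfolding cq using that by simp
    moreover have "z \<noteq> of_real \<rho>" using that q\<rho> by auto
    ultimately show ?thesis using iso by (auto simp: isolated_root_near_def)
  qed
  with cq q\<rho> show thesis by (rule that)
qed

section \<open>Growth of positive solutions\<close>

lemma real_limit_of_complex:
  assumes "(\<lambda>n. complex_of_real (x n)) \<longlonglongrightarrow> K"
  shows "x \<longlonglongrightarrow> Re K" "Im K = 0"
  using tendsto_Re[OF assms] LIMSEQ_unique[OF tendsto_Im[OF assms], of 0] by simp_all

text \<open>\<open>\<rho> ^ n\<close> solves the same recurrence and nonnegative coefficients
  preserve inequalities, so the smallest ratio over the initial block persists. This keeps the limit
  of \<open>a n / \<rho> ^ n\<close> away from 0.\<close>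

lemma nonneg_recurrence_lower_bound:
  fixes a :: "nat \<Rightarrow> real"
  assumes nonneg: "\<And>i. i < k \<Longrightarrow> c i \<ge> 0" and k: "k > 0"
    and \<rho>: "\<rho> > 0" "\<rho> ^ k = (\<Sum>j<k. c j * \<rho> ^ j)"
    and pos: "\<And>n. a n > 0" and rec: "\<And>n. a (n + k) = (\<Sum>j<k. c j * a (n + j))"
  obtains \<epsilon> where "\<epsilon> > 0" "\<And>n. a n \<ge> \<epsilon> * \<rho> ^ n"
proof -
  define \<epsilon> where "\<epsilon> = Min ((\<lambda>n. a n / \<rho> ^ n) ` {..<k})"
  have ne: "{..<k} \<noteq> {}" using k by auto
  have "\<epsilon> > 0" unfolding \<epsilon>_def using ne pos \<rho> by (subst Min_gr_iff) auto
  moreover have "a n \<ge> \<epsilon> * \<rho> ^ n" for n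
  proof (induction n rule: less_induct)
    case (less n)
    show ?case
    proof (cases "n < k")
      case True
      then have "\<epsilon> \<le> a n / \<rho> ^ n" unfolding \<epsilon>_def by (intro Min_le) auto
      then show ?thesis using \<rho> by (simp add: field_simps)
    next
      case False
      then obtain i where i: "n = i + k" by (metis add.commute le_Suc_ex not_less)
      have "\<epsilon> * \<rho> ^ n = (\<Sum>j<k. c j * (\<epsilon> * \<rho> ^ (i + j)))"
        by (simp add: i power_add \<rho>(2) sum_distrib_left mult_ac)
      also have "\<dots> \<le> (\<Sum>j<k. c j * a (i + j))"
        using nonneg less i by (intro sum_mono mult_left_mono) auto
      finally show ?thesis using rec i by simp
    qed
  qed
  ultimately show thesis by (rule that)
qed

text \<open>The two alternatives differ in why the limit is positive: a lower bound by a multiple of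
  \<open>\<rho> ^ n\<close> in the first, the assumption that \<open>a\<close> does not tend to 0 in
  the second.\<close>

lemma recurrence_growth:
  fixes a :: "nat \<Rightarrow> real"
  assumes k: "k > 0"
    and root: "(\<forall>i<k. c i \<ge> 0) \<and> dominant_root (rec_poly k c) \<rho> \<or>
        d \<ge> 2 \<and> isolated_root_near d (rec_poly k c) \<rho> \<and> \<not> a \<longlonglongrightarrow> 0"
    and pos: "\<And>n. n \<ge> 1 \<Longrightarrow> a n > 0"
    and rec: "\<And>n. n \<ge> 1 \<Longrightarrow> a (n + k) = (\<Sum>j<k. c j * a (n + j))"
  obtains K where "\<rho> > 0" "K > 0" "(\<lambda>n. a n / \<rho> ^ n) \<longlonglongrightarrow> K"
proof -
  \<comment> \<open>The recurrence is assumed from index 1 on, so the operator acts on the shifted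
    sequence.\<close>
  define A where "A n = complex_of_real (a (Suc n))" for n
  have recA: "lin_op (complex_poly (rec_poly k c)) A n = 0" for n
    using rec[of "Suc n"] by (simp add: lin_op_rec_poly A_def)
  have "\<exists>K>0. \<rho> > 0 \<and> (\<lambda>n. a (Suc n) / \<rho> ^ n) \<longlonglongrightarrow> K"
    using root
  proof (elim disjE conjE)
    assume nonneg: "\<forall>i<k. c i \<ge> 0" and dom: "dominant_root (rec_poly k c) \<rho>"
    obtain q where q: "complex_poly (rec_poly k c) = [:-of_real \<rho>, 1:] * q" "poly q (of_real \<rho>) \<noteq> 0"
        "\<And>z. poly q z = 0 \<Longrightarrow> norm z < \<rho>"
      using dominant_root_factor[OF dom] by auto
    have \<rho>: "\<rho> > 0" "poly (rec_poly k c) \<rho> = 0" using dom by (auto simp: dominant_root_def)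
    obtain K where K: "(\<lambda>n. (A n - K * of_real \<rho> ^ n) / of_real \<rho> ^ n) \<longlonglongrightarrow> 0"
      using recurrence_asymptotics[OF q(2,3) \<rho>(1) recA[unfolded q(1)]] by blast
    have "(\<lambda>n. (A n - K * of_real \<rho> ^ n) / of_real \<rho> ^ n + K) \<longlonglongrightarrow> 0 + K"
      by (intro tendsto_add K tendsto_const)
    moreover have "(A n - K * of_real \<rho> ^ n) / of_real \<rho> ^ n + K = of_real (a (Suc n) / \<rho> ^ n)" for n
      using \<rho> by (simp add: A_def field_simps)
    ultimately have lim: "(\<lambda>n. a (Suc n) / \<rho> ^ n) \<longlonglongrightarrow> Re K"
      using real_limit_of_complex(1)[of "\<lambda>n. a (Suc n) / \<rho> ^ n" K] by simp
    obtain \<epsilon> where \<epsilon>: "\<epsilon> > 0" "\<And>n. a (Suc n) \<ge> \<epsilon> * \<rho> ^ n"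
    proof (rule nonneg_recurrence_lower_bound[of k c \<rho> "\<lambda>n. a (Suc n)"])
      show "\<rho> ^ k = (\<Sum>j<k. c j * \<rho> ^ j)" using \<rho>(2) by (simp add: poly_rec_poly)
      show "a (Suc (n + k)) = (\<Sum>j<k. c j * a (Suc (n + j)))" for n using rec[of "Suc n"] by simp
    qed (use nonneg k \<rho> pos in auto)
    have "Re K \<ge> \<epsilon>"
      using \<rho> \<epsilon>(2) by (intro LIMSEQ_le_const[OF lim]) (auto simp: field_simps)
    then show ?thesis using lim \<epsilon> \<rho> by (intro exI[of _ "Re K"]) auto
  next
    assume d: "d \<ge> 2" and iso: "isolated_root_near d (rec_poly k c) \<rho>" and nz: "\<not> a \<longlonglongrightarrow> 0"
    obtain q where q: "complex_poly (rec_poly k c) = [:-of_real \<rho>, 1:] * q" "poly q (of_real \<rho>) \<noteq> 0"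
        "\<And>z. poly q z = 0 \<Longrightarrow> norm z < 1"
      using isolated_root_factor[OF iso] by auto
    have \<rho>: "\<rho> > 1" using iso d by (auto simp: isolated_root_near_def)
    obtain K where "(\<lambda>n. (A n - K * of_real \<rho> ^ n) / of_real 1 ^ n) \<longlonglongrightarrow> 0"
      using recurrence_asymptotics[OF q(2,3) zero_less_one recA[unfolded q(1)]] by blast
    then have K: "(\<lambda>n. A n - K * of_real \<rho> ^ n) \<longlonglongrightarrow> 0" by simp
    have "(\<lambda>n. (A n - K * of_real \<rho> ^ n) * (1 / of_real \<rho>) ^ n + K) \<longlonglongrightarrow> 0 * 0 + K"
      using \<rho> by (intro tendsto_add tendsto_mult K tendsto_const LIMSEQ_power_zero) (simp add: norm_divide)
    moreover have "(A n - K * of_real \<rho> ^ n) * (1 / of_real \<rho>) ^ n + K = of_real (a (Suc n) / \<rho> ^ n)" for n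
      using \<rho> by (simp add: A_def field_simps)
    ultimately have clim: "(\<lambda>n. of_real (a (Suc n) / \<rho> ^ n)) \<longlonglongrightarrow> K" by simp
    note lim = real_limit_of_complex[OF clim]
    \<comment> \<open>Here the error tends to 0 without any scaling, so \<open>K = 0\<close> would
      make \<open>a\<close> itself tend to 0.\<close>
    have "K \<noteq> 0"
    proof
      assume "K = 0"
      with K have "(\<lambda>n. complex_of_real (a (Suc n))) \<longlonglongrightarrow> 0" by (simp add: A_def)
      then have "(\<lambda>n. a (Suc n)) \<longlonglongrightarrow> 0" using real_limit_of_complex(1) by fastforce
      then show False using nz LIMSEQ_imp_Suc by blast
    qed
    moreover have "Re K \<ge> 0"
      using \<rho> pos by (intro LIMSEQ_le_const[OF lim(1)]) (auto intro!: exI[of _ 0] divide_nonneg_nonneg less_imp_le)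
    ultimately have "Re K > 0" using lim(2) by (auto simp: complex_eq_iff less_le)
    then show ?thesis using lim(1) \<rho> by (intro exI[of _ "Re K"]) auto
  qed
  then obtain K where K: "K > 0" "\<rho> > 0" "(\<lambda>n. a (Suc n) / \<rho> ^ n) \<longlonglongrightarrow> K" by blast
  \<comment> \<open>One more division by \<open>\<rho>\<close> compensates for the index
    shift.\<close>
  have "(\<lambda>n. a (Suc n) / \<rho> ^ n / \<rho>) \<longlonglongrightarrow> K / \<rho>" using K by (intro tendsto_divide tendsto_const) auto
  then have "(\<lambda>n. a (Suc n) / \<rho> ^ Suc n) \<longlonglongrightarrow> K / \<rho>" by (simp add: mult.commute)
  then have "(\<lambda>n. a n / \<rho> ^ n) \<longlonglongrightarrow> K / \<rho>" by (rule LIMSEQ_imp_Suc)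
  with K show thesis by (intro that[of "K / \<rho>"]) auto
qed

section \<open>Benford's law\<close>

text \<open>The integer part of \<open>log (real b) u\<close> is the exponent of \<open>b\<close>,
  and the fractional part is the logarithm of the mantissa.\<close>

lemma mantissa_eq_powr_frac:
  assumes b: "b > 1" and u: "u > 0"
  shows "mantissa b u = real b powr frac (log (real b) u)"
  unfolding mantissa_def
proof (rule the_equality)
  have "real b powr frac (log (real b) u) \<ge> real b powr 0"
    using b by (intro powr_mono) auto
  moreover have "real b powr frac (log (real b) u) < real b powr 1"
    using b frac_lt_1 by (intro powr_less_mono) auto
  moreover have "u = real b powr frac (log (real b) u) * real b powi \<lfloor>log (real b) u\<rfloor>"
  proof -
    have "u = real b powr (frac (log (real b) u) + of_int \<lfloor>log (real b) u\<rfloor>)"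
      using b u by (simp add: frac_def)
    also have "\<dots> = real b powr frac (log (real b) u) * real b powr of_int \<lfloor>log (real b) u\<rfloor>"
      by (rule powr_add)
    finally show ?thesis using b by (simp add: powr_real_of_int')
  qed
  ultimately show "real b powr frac (log (real b) u) \<in> {1..<real b} \<and>
      (\<exists>m. u = real b powr frac (log (real b) u) * real b powi m)"
    using b by auto
next
  fix x assume "x \<in> {1..<real b} \<and> (\<exists>m. u = x * real b powi m)"
  then obtain m where x: "1 \<le> x" "x < real b" and ux: "u = x * real b powr of_int m"
    using b by (auto simp: powr_real_of_int')
  have "log (real b) u = log (real b) x + of_int m"
    unfolding ux using x b by (simp add: log_mult)
  moreover have "0 \<le> log (real b) x" "log (real b) x < 1" using x b by auto
  ultimately have "frac (log (real b) u) = log (real b) x" by (simp add: frac_unique_iff)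
  then show "x = real b powr frac (log (real b) u)" using x b by simp
qed

text \<open>The mantissa is below \<open>t\<close> exactly when the fractional part of the logarithm
  is below \<open>log (real b) t\<close>, so Weyl's criterion applies. \<open>Suc\<close> matches
  its count from 0 with the count from 1 in \<open>benford\<close>.\<close>

lemma benford_of_mean_null:
  assumes b: "b > 1" and pos: "\<And>n. n \<ge> 1 \<Longrightarrow> u n > 0"
    and mean: "\<And>h::int. h \<noteq> 0 \<Longrightarrow> mean_null (\<lambda>n. cis (2 * pi * (of_int h * log (real b) (u (Suc n)))))"
  shows "benford b u"
  unfolding benford_def
proof (intro conjI ballI allI impI)
  fix t assume t: "t \<in> {1..<real b}"
  have "card {n \<in> {1..N}. mantissa b (u n) < t} = card {n \<in> {..<N}. frac (log (real b) (u (Suc n))) < log (real b) t}" for N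
  proof -
    have "mantissa b (u n) < t \<longleftrightarrow> frac (log (real b) (u n)) < log (real b) t" if "n \<ge> 1" for n
      using b t pos[OF that] by (simp add: mantissa_eq_powr_frac less_log_iff)
    then have "{n \<in> {1..N}. mantissa b (u n) < t} = Suc ` {n \<in> {..<N}. frac (log (real b) (u (Suc n))) < log (real b) t}"
      by (auto simp: image_iff Suc_le_eq gr0_conv_Suc)
    then show ?thesis by (simp add: card_image)
  qed
  moreover have "0 \<le> log (real b) t" "log (real b) t \<le> 1" using t b by auto
  ultimately show "(\<lambda>N. real (card {n \<in> {1..N}. mantissa b (u n) < t}) / real N) \<longlonglongrightarrow> log (real b) t"
    using Weyl_criterion[OF mean] by simp
qed (use pos in auto)

text \<open>The difference of the two exponentials has the norm of
  \<open>cis (x n - y n) - 1\<close>; it is a null sequence and does not affect the mean.\<close>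

lemma mean_null_cis_cong:
  assumes "mean_null (\<lambda>n. cis (y n))" and "(\<lambda>n. x n - y n) \<longlonglongrightarrow> 0"
  shows "mean_null (\<lambda>n. cis (x n))"
proof -
  have "(\<lambda>n. cis (y n) * (cis (x n - y n) - 1)) \<longlonglongrightarrow> 0"
  proof (rule Lim_null_comparison)
    have "(\<lambda>n. cis (x n - y n) - 1) \<longlonglongrightarrow> cis 0 - 1"
      by (rule tendsto_diff[OF tendsto_cis[OF assms(2)] tendsto_const])
    then show "(\<lambda>n. norm (cis (x n - y n) - 1)) \<longlonglongrightarrow> 0" using tendsto_norm_zero by fastforce
  qed (simp add: norm_mult)
  from mean_null_add[OF assms(1) mean_null_of_tendsto_0[OF this]] show ?thesis
    by (simp add: right_diff_distrib cis_mult)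
qed

section \<open>Polynomial subsequences\<close>

text \<open>A non-constant polynomial takes each value at finitely many points only, so its values
  leave every bounded set of natural numbers.\<close>

lemma filterlim_int_poly:
  fixes Q :: "int poly"
  assumes deg: "degree Q \<ge> 1" and Q: "\<And>n. n > n0 \<Longrightarrow> poly Q (int n) \<ge> 1"
  shows "filterlim (\<lambda>n. nat (poly Q (int (n0 + Suc n)))) at_top sequentially"
  unfolding filterlim_at_top
proof
  fix Z :: nat
  have "finite {x. poly Q x = int z}" for z
  proof -
    have "Q - [:int z:] \<noteq> 0" using deg by auto
    from poly_roots_finite[OF this] show ?thesis by simp
  qed
  then have "finite (\<Union>z\<in>{..Z}. {x. poly Q x = int z})" by auto
  then have "finite ((\<lambda>n. int (n0 + Suc n)) -` (\<Union>z\<in>{..Z}. {x. poly Q x = int z}))"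
    by (rule finite_vimageI) (auto simp: inj_on_def)
  moreover have "{n. \<not> Z \<le> nat (poly Q (int (n0 + Suc n)))} \<subseteq> (\<lambda>n. int (n0 + Suc n)) -` (\<Union>z\<in>{..Z}. {x. poly Q x = int z})"
  proof
    fix n assume n: "n \<in> {n. \<not> Z \<le> nat (poly Q (int (n0 + Suc n)))}"
    have "poly Q (int (n0 + Suc n)) \<ge> 1" by (intro Q) simp
    then have "poly Q (int (n0 + Suc n)) = int (nat (poly Q (int (n0 + Suc n))))" by simp
    moreover have "nat (poly Q (int (n0 + Suc n))) \<le> Z" using n by simp
    ultimately show "n \<in> (\<lambda>n. int (n0 + Suc n)) -` (\<Union>z\<in>{..Z}. {x. poly Q x = int z})"
      unfolding vimage_eq UN_iff mem_Collect_eq atMost_iff by blast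
  qed
  ultimately have "finite {n. \<not> Z \<le> nat (poly Q (int (n0 + Suc n)))}" by (rule finite_subset[rotated])
  then show "\<forall>\<^sub>F n in sequentially. Z \<le> nat (poly Q (int (n0 + Suc n)))"
    by (simp add: eventually_cofinite flip: cofinite_eq_sequentially)
qed

text \<open>Along \<open>m = Q(n0 + n)\<close> the logarithm of \<open>a m\<close> is
  \<open>m * log (real b) \<rho> + log (real b) K\<close> up to a null sequence. Multiplied by
  \<open>h \<noteq> 0\<close>, this main term is a polynomial in \<open>n\<close> with irrational
  leading coefficient.\<close>

theorem benford_geometric_growth_poly:
  fixes Q :: "int poly" and a :: "nat \<Rightarrow> real"
  assumes b: "b > 1" and \<rho>: "\<rho> > 0" and irr: "log (real b) \<rho> \<notin> \<rat>"
    and pos: "\<And>n. n \<ge> 1 \<Longrightarrow> a n > 0" and K: "K > 0" "(\<lambda>n. a n / \<rho> ^ n) \<longlonglongrightarrow> K"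
    and deg: "degree Q \<ge> 1" and Q: "\<And>n. n > n0 \<Longrightarrow> poly Q (int n) \<ge> 1"
  shows "benford b (\<lambda>n. a (nat (poly Q (int (n0 + n)))))"
proof (rule benford_of_mean_null[OF b])
  define m where "m n = nat (poly Q (int (n0 + Suc n)))" for n
  have Q1: "poly Q (int (n0 + n)) \<ge> 1" if "n \<ge> 1" for n using that by (intro Q) simp
  show "a (nat (poly Q (int (n0 + n)))) > 0" if "n \<ge> 1" for n
    using Q1[OF that] by (intro pos) simp
  fix h :: int assume h: "h \<noteq> 0"
  define \<theta> where "\<theta> = log (real b) \<rho>"
  \<comment> \<open>The main term in the unshifted variable; the offset \<open>Suc n0\<close> enters
    later through translation invariance of the mean. Its top coefficient is \<open>\<theta>\<close>
    times a nonzero integer.\<close>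
  define P where "P = smult (of_int h * \<theta>) (map_poly real_of_int Q) + [:of_int h * log (real b) K:]"
  obtain d where d: "degree Q = Suc d" using deg by (cases "degree Q") auto
  have PQ: "poly P (real n) = of_int h * \<theta> * of_int (poly Q (int n)) + of_int h * log (real b) K" for n
    by (simp add: P_def flip: of_int_poly) (simp add: poly_altdef degree_map_poly coeff_map_poly)
  have "degree P \<le> Suc d"
    unfolding P_def using d by (intro degree_add_le order_trans[OF degree_smult_le]) (auto simp: degree_map_poly)
  moreover have "coeff P (Suc d) \<notin> \<rat>"
  proof
    have lc: "coeff Q (Suc d) \<noteq> 0" using d by (metis leading_coeff_0_iff degree_0 nat.distinct(1))
    assume "coeff P (Suc d) \<in> \<rat>"
    then have "coeff P (Suc d) / of_int (h * coeff Q (Suc d)) \<in> \<rat>" by (intro Rats_divide Rats_of_int)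
    also have "coeff P (Suc d) / of_int (h * coeff Q (Suc d)) = \<theta>"
      using h lc by (simp add: P_def coeff_map_poly)
    finally show False using irr by (simp add: \<theta>_def)
  qed
  ultimately have "mean_null (\<lambda>n. cis (2 * pi * poly P (real n)))" by (rule mean_null_poly_phase)
  then have mean: "mean_null (\<lambda>n. cis (2 * pi * poly P (real (n + Suc n0))))"
    by (intro mean_null_shift[where B = 1]) auto
  have "filterlim m at_top sequentially"
    unfolding m_def using deg Q by (rule filterlim_int_poly)
  then have "(\<lambda>n. a (m n) / \<rho> ^ m n) \<longlonglongrightarrow> K" by (rule filterlim_compose[OF K(2)])
  then have "(\<lambda>n. log (real b) (a (m n) / \<rho> ^ m n)) \<longlonglongrightarrow> log (real b) K"
    using b K(1) by (intro tendsto_log tendsto_const) auto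
  then have "(\<lambda>n. 2 * pi * (of_int h * (log (real b) (a (m n) / \<rho> ^ m n) - log (real b) K))) \<longlonglongrightarrow> 2 * pi * (of_int h * (log (real b) K - log (real b) K))"
    by (intro tendsto_mult tendsto_diff tendsto_const)
  moreover have "2 * pi * (of_int h * (log (real b) (a (m n) / \<rho> ^ m n) - log (real b) K)) =
      2 * pi * (of_int h * log (real b) (a (m n))) - 2 * pi * poly P (real (n + Suc n0))" for n
  proof -
    have m: "poly Q (int (n + Suc n0)) = int (m n)" "m n \<ge> 1"
      using Q1[of "Suc n"] by (auto simp: m_def add.commute)
    have "log (real b) (a (m n) / \<rho> ^ m n) = log (real b) (a (m n)) - real (m n) * \<theta>"
      using b \<rho> pos[OF m(2)] by (simp add: log_divide log_nat_power \<theta>_def)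
    then show ?thesis unfolding PQ m(1) by (simp only:) (simp add: algebra_simps)
  qed
  ultimately have "(\<lambda>n. 2 * pi * (of_int h * log (real b) (a (m n))) - 2 * pi * poly P (real (n + Suc n0))) \<longlonglongrightarrow> 0"
    by simp
  from mean_null_cis_cong[OF mean this]
  show "mean_null (\<lambda>n. cis (2 * pi * (of_int h * log (real b) (a (nat (poly Q (int (n0 + Suc n))))))))"
    by (simp only: m_def)
qed

text \<open>In the third part \<open>\<rho>\<close> ranges over every root with the stated property,
  so it is not tied to the witnesses of the first two parts. The offset \<open>n0\<close> starts the
  subsequence where \<open>Q\<close> is known to be at least 1.\<close>

theorem mainTheorem1:
  fixes k :: nat and c :: "nat \<Rightarrow> real"
  assumes "k \<ge> 1" and "inner_support k c \<noteq> {}"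
  shows
    "((\<forall>i<k. c i \<ge> 0) \<and> c 0 > 0 \<longrightarrow>
        ((\<exists>\<rho>. dominant_root (rec_poly k c) \<rho>) \<longleftrightarrow> Gcd (inner_support k c \<union> {k}) = 1))
   \<and> (large_top_coeff k c \<longrightarrow> (\<exists>\<rho>. isolated_root_near (c (k - 1)) (rec_poly k c) \<rho>))
   \<and> (\<forall>(\<rho>::real) (b::nat) (a::nat \<Rightarrow> real).
        ((\<forall>i<k. c i \<ge> 0) \<and> c 0 > 0 \<and> Gcd (inner_support k c \<union> {k}) = 1
            \<and> dominant_root (rec_poly k c) \<rho>
         \<or> large_top_coeff k c \<and> isolated_root_near (c (k - 1)) (rec_poly k c) \<rho>
            \<and> \<not> a \<longlonglongrightarrow> 0)
        \<and> b > 2 \<and> log (real b) \<rho> \<notin> \<rat>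
        \<and> (\<forall>n\<ge>1. a n > 0)
        \<and> (\<forall>n\<ge>1. a (n + k) = (\<Sum>j<k. c j * a (n + j)))
        \<longrightarrow> benford b a
          \<and> (\<forall>(Q::int poly) (n0::nat).
               degree Q \<ge> 1 \<and> (\<forall>n>n0. poly Q (int n) \<ge> 1)
               \<longrightarrow> benford b (\<lambda>n. a (nat (poly Q (int (n0 + n)))))))"
proof (intro conjI impI allI, goal_cases)
  case 1
  then show ?case using nonneg_rec_poly_dominant_root_iff[of k c] assms(1) by simp
next
  case 2
  \<comment> \<open>Some \<open>j\<close> with \<open>1 \<le> j \<le> k - 1\<close> exists, so
    \<open>k\<close> is at least 2.\<close>
  obtain m where "k = Suc (Suc m)"
  proof -
    obtain j where "1 \<le> j" "j \<le> k - 1" using assms(2) by (auto simp: inner_support_def)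
    then have "k = Suc (Suc (k - 2))" by simp
    then show thesis by (rule that)
  qed
  then show ?case using rec_poly_large_top_coeff_root[of m c] 2 by simp
next
  case (3 \<rho> b a)
  obtain K where K: "\<rho> > 0" "K > 0" "(\<lambda>n. a n / \<rho> ^ n) \<longlonglongrightarrow> K"
    by (rule recurrence_growth[of k c \<rho> "c (k - 1)" a]) (use 3 assms(1) in \<open>auto simp: large_top_coeff_def\<close>)
  \<comment> \<open>The polynomial \<open>x\<close> with offset 0 gives back the sequence
    itself.\<close>
  have "benford b (\<lambda>n. a (nat (poly (monom 1 1) (int (0 + n)))))"
    using 3 by (intro benford_geometric_growth_poly[OF _ K(1) _ _ K(2,3)]) (auto simp: degree_monom_eq poly_monom)
  then show ?case by (simp add: poly_monom)
next
  case (4 \<rho> b a Q n0)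
  obtain K where K: "\<rho> > 0" "K > 0" "(\<lambda>n. a n / \<rho> ^ n) \<longlonglongrightarrow> K"
    by (rule recurrence_growth[of k c \<rho> "c (k - 1)" a]) (use 4 assms(1) in \<open>auto simp: large_top_coeff_def\<close>)
  show ?case
    using 4 by (intro benford_geometric_growth_poly[OF _ K(1) _ _ K(2,3)]) auto
qed

end
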